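(* Let $R$ be a factorial domain, $K$ a field of quotients of $R$, $X$ an indeterminate over $K$, $a\in R$ and $f,g\in R[X]^{\bullet}$ such that ${\rm GCD}_{R[X]}(f,g)=R[X]^{\times}$, ${\rm GCD}_R(f(a),g(a))=R^{\times}$ and $d(rs)=d(r)d(s)$ for all $r\in[\![f]\!]$ and $s\in[\![g]\!]$. Then $\mathcal{C}_v([\![fg]\!])\cong\mathcal{C}_v([\![f]\!])\times\mathcal{C}_v([\![g]\!])$.
   Context: For a domain $D$, $D^{\bullet}=D\setminus\{0\}$ is a multiplicative monoid, $D^{\times}$ its unit group; ${\rm GCD}_D(a,b)$ is the set of all greatest common divisors of $a,b$ in $D$ (so ${\rm GCD}_D(a,b)=D^{\times}$ means that $a,b$ are coprime). ${\rm Int}(R)=\{h\in K[X]\mid h(c)\in R\text{ for all }c\in R\}$. For $f\in{\rm Int}(R)^{\bullet}$, $[\![f]\!]=\{h\in{\rm Int}(R)^{\bullet}\mid h\text{ divides }f^k\text{ in }{\rm Int}(R)\text{ for some }k\in\mathbb{N}_0\}$; it is known that $[\![f]\!]$ is a Krull monoid. For a monoid $H$ (commutative, cancellative) with quotient group $L$ and $Y\subseteq L$ put $Y^{-1}=\{z\in L\mid zY\subseteq H\}$ and $Y_v=(Y^{-1})^{-1}$. For a Krull monoid $H$, the divisor-class group $\mathcal{C}_v(H)$ is the group of nonempty fractional $v$-ideals of $H$ under $(I,J)\mapsto(IJ)_v$ modulo the subgroup of principal fractional ideals. Fix a system $\mathcal{Q}$ of representatives (up to associates) of the prime elements of $R$;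 for $p\in\mathcal{Q}$, $\mathrm{v}_p:R\to\mathbb{N}_0\cup\{\infty\}$ is the $p$-adic valuation, and $d:{\rm Int}(R)^{\bullet}\to R^{\bullet}$ is defined by $d(h)=\prod_{p\in\mathcal{Q}}p^{\min\{\mathrm{v}_p(h(c))\mid c\in R\}}$. *)

theory Defs
  imports
    "HOL-Computational_Algebra.Computational_Algebra"
    "HOL-Library.Extended_Nat"
    "HOL-Algebra.Coset"
begin

section \<open>Divisor-class groups of monoids\<close>

text \<open>
  A commutative cancellative monoid is represented by a subset \<open>H\<close> of (the carrier of) an abelian
  group \<open>L\<close>; the notions below are meant for the case that \<open>L\<close> is a quotient group of \<open>H\<close>.
\<close>

definition v_inverse :: "('g, 'm) monoid_scheme \<Rightarrow> 'g set \<Rightarrow> 'g set \<Rightarrow> 'g set" where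
  "v_inverse L H Y = {z \<in> carrier L. z <#\<^bsub>L\<^esub> Y \<subseteq> H}"

definition v_closure :: "('g, 'm) monoid_scheme \<Rightarrow> 'g set \<Rightarrow> 'g set \<Rightarrow> 'g set" where
  "v_closure L H Y = v_inverse L H (v_inverse L H Y)"

definition fractional_v_ideals :: "('g, 'm) monoid_scheme \<Rightarrow> 'g set \<Rightarrow> 'g set set" where
  "fractional_v_ideals L H =
     {I. I \<subseteq> carrier L \<and> I \<noteq> {} \<and> (\<exists>c\<in>H. c <#\<^bsub>L\<^esub> I \<subseteq> H) \<and> v_closure L H I = I}"

definition v_ideal_group :: "('g, 'm) monoid_scheme \<Rightarrow> 'g set \<Rightarrow> 'g set monoid" where
  "v_ideal_group L H =
     \<lparr>carrier = fractional_v_ideals L H,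
      mult = (\<lambda>I J. v_closure L H (I <#>\<^bsub>L\<^esub> J)),
      one = H\<rparr>"

definition principal_ideals :: "('g, 'm) monoid_scheme \<Rightarrow> 'g set \<Rightarrow> 'g set set" where
  "principal_ideals L H = {z <#\<^bsub>L\<^esub> H | z. z \<in> carrier L}"

definition v_class_group :: "('g, 'm) monoid_scheme \<Rightarrow> 'g set \<Rightarrow> 'g set set monoid" where
  "v_class_group L H = v_ideal_group L H Mod principal_ideals L H"

text \<open>
  For a multiplicative monoid \<open>M\<close> of nonzero elements of an integral domain, the quotient group is
  realised inside the multiplicative group of the quotient field of that domain.
\<close>

definition quotient_group :: "'b::idom set \<Rightarrow> 'b fract monoid" where
  "quotient_group M = \<lparr>carrier = {Fract x y | x y. x \<in> M \<and> y \<in> M}, mult = (*), one = 1\<rparr>"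

definition class_group_v :: "'b::idom set \<Rightarrow> 'b fract set set monoid" where
  "class_group_v M = v_class_group (quotient_group M) (to_fract ` M)"


section \<open>Greatest common divisors and systems of primes\<close>

definition GCD_set :: "'a::comm_semiring_1 \<Rightarrow> 'a \<Rightarrow> 'a set" where
  "GCD_set a b = {c. c dvd a \<and> c dvd b \<and> (\<forall>e. e dvd a \<and> e dvd b \<longrightarrow> e dvd c)}"

definition prime_representatives :: "'a::comm_semiring_1 set \<Rightarrow> bool" where
  "prime_representatives Q \<longleftrightarrow>
     (\<forall>p\<in>Q. prime_elem p) \<and> (\<forall>q. prime_elem q \<longrightarrow> (\<exists>!p\<in>Q. p dvd q \<and> q dvd p))"

text \<open>The constant \<^const>\<open>multiplicity\<close> has value \<open>0\<close> at \<open>0\<close>, so that case is corrected here.\<close>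

definition padic_val :: "'a::factorial_semiring \<Rightarrow> 'a \<Rightarrow> enat" where
  "padic_val p x = (if x = 0 then \<infinity> else enat (multiplicity p x))"


section \<open>Integer-valued polynomials\<close>

definition Int_poly :: "'a::idom fract poly set" where
  "Int_poly = {h. \<forall>c. poly h (to_fract c) \<in> range to_fract}"

definition divisor_closure :: "'a::idom fract poly \<Rightarrow> 'a fract poly set" where
  "divisor_closure f =
     {h \<in> Int_poly - {0}. \<exists>k::nat. \<exists>u\<in>Int_poly. f ^ k = h * u}"

definition fixed_exponent :: "'a::{factorial_semiring, idom} \<Rightarrow> 'a fract poly \<Rightarrow> enat" where
  "fixed_exponent p h = Inf {padic_val p x | x c. to_fract x = poly h (to_fract c)}"

text \<open>
  The product runs over the primes with nonzero exponent only, since \<^const>\<open>prod\<close> over an infinite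
  set is \<open>1\<close>. For nonzero \<open>h\<close> these primes are finitely many and all exponents are finite:
  either \<open>h\<close> has a nonzero value, or the domain is finite and hence has no primes.
\<close>

definition fixed_divisor :: "'a::{factorial_semiring, idom} set \<Rightarrow> 'a fract poly \<Rightarrow> 'a" where
  "fixed_divisor Q h =
     (\<Prod>p | p \<in> Q \<and> fixed_exponent p h \<noteq> 0. p ^ the_enat (fixed_exponent p h))"

end

theory Submission
  imports Defs "HOL-Library.Set_Algebras"
begin

text \<open>
  Write \<open>M\<close> and \<open>N\<close> for the divisor closures of \<open>f\<close> and \<open>g\<close>. Up to units, the divisor closure of
  \<open>f * g\<close> is the direct product of \<open>M\<close> and \<open>N\<close>. Indeed, a divisor \<open>h\<close> of a power of \<open>f * g\<close> is a
  constant times \<open>r * s\<close>, where \<open>r\<close> and \<open>s\<close> divide powers of \<open>f\<close> and \<open>g\<close> over the base ring (Gauss);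
  by multiplicativity of the fixed divisor, a prime in the denominator of the constant divides all
  values of \<open>r\<close> or all values of \<open>s\<close>, and a prime in its numerator lies in \<open>M\<close> or in \<open>N\<close>, so the
  constant can be absorbed. If \<open>r / r' = s / s'\<close> with \<open>r, r' \<in> M\<close> and \<open>s, s' \<in> N\<close>, then coprimality of
  \<open>f\<close> and \<open>g\<close> makes this quotient a constant, and evaluation at \<open>a\<close> makes it a unit. Hence the
  quotient groups of \<open>M\<close> and \<open>N\<close> meet in units only, every \<open>v\<close>-ideal of \<open>M * N\<close> is the product of
  its two projections, and principal ideals correspond to pairs of principal ideals.
\<close>

section \<open>Ideals in products of monoids\<close>

text \<open>The bijection \<open>\<psi>\<close> carries each coset of \<open>P\<close> to a
  rectangle of cosets of \<open>P1\<close> and \<open>P2\<close>, and a nonempty rectangle is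
  determined by its two sides. The form for arbitrary multiplicative structures lets it be applied
  to \<open>v\<close>-ideals without verifying group axioms for them.\<close>

lemma FactGroup_product_iso:
  assumes hom: "\<psi> \<in> hom G (G1 \<times>\<times> G2)"
    and inj: "inj_on \<psi> (carrier G)"
    and surj: "\<psi> ` carrier G = carrier G1 \<times> carrier G2"
    and P: "P \<subseteq> carrier G" "P \<noteq> {}" "\<psi> ` P = P1 \<times> P2"
    and closed: "\<And>x y. x \<in> carrier G \<Longrightarrow> y \<in> carrier G \<Longrightarrow> x \<otimes>\<^bsub>G\<^esub> y \<in> carrier G"
  shows "G Mod P \<cong> (G1 Mod P1) \<times>\<times> (G2 Mod P2)"
proof -
  define \<Phi> where "\<Phi> A = (fst ` \<psi> ` A, snd ` \<psi> ` A)" for A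
  have fst_mult: "fst (\<psi> (x \<otimes>\<^bsub>G\<^esub> y)) = fst (\<psi> x) \<otimes>\<^bsub>G1\<^esub> fst (\<psi> y)"
    and snd_mult: "snd (\<psi> (x \<otimes>\<^bsub>G\<^esub> y)) = snd (\<psi> x) \<otimes>\<^bsub>G2\<^esub> snd (\<psi> y)"
    if "x \<in> carrier G" "y \<in> carrier G" for x y
    using hom_mult[OF hom that] by (simp_all add: DirProd_def split_beta)
  have P1: "fst ` \<psi> ` P = P1" and P2: "snd ` \<psi> ` P = P2"
  proof -
    have "P1 \<times> P2 \<noteq> {}" using P(2,3) by auto
    then show "fst ` \<psi> ` P = P1" "snd ` \<psi> ` P = P2"
      unfolding P(3) by auto
  qed
  have coset: "\<psi> ` (P #>\<^bsub>G\<^esub> x) = (P1 #>\<^bsub>G1\<^esub> fst (\<psi> x)) \<times> (P2 #>\<^bsub>G2\<^esub> snd (\<psi> x))"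
    if x: "x \<in> carrier G" for x
  proof -
    have "\<psi> ` (P #>\<^bsub>G\<^esub> x) = (\<lambda>p. \<psi> (p \<otimes>\<^bsub>G\<^esub> x)) ` P"
      by (auto simp: r_coset_def)
    also have "\<dots> = (\<lambda>p. (fst (\<psi> p) \<otimes>\<^bsub>G1\<^esub> fst (\<psi> x), snd (\<psi> p) \<otimes>\<^bsub>G2\<^esub> snd (\<psi> x))) ` P"
      using P(1) x by (intro image_cong refl prod_eqI) (auto simp: fst_mult snd_mult)
    also have "\<dots> = (\<lambda>q. (fst q \<otimes>\<^bsub>G1\<^esub> fst (\<psi> x), snd q \<otimes>\<^bsub>G2\<^esub> snd (\<psi> x))) ` (P1 \<times> P2)"
      unfolding P(3)[symmetric] by (simp add: image_image)
    also have "\<dots> = (P1 #>\<^bsub>G1\<^esub> fst (\<psi> x)) \<times> (P2 #>\<^bsub>G2\<^esub> snd (\<psi> x))"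
      by (force simp: r_coset_def)
    finally show ?thesis .
  qed
  \<comment> \<open>If one side were empty, the whole rectangle would be empty and the other side
    could not be recovered from it.\<close>
  have ne: "P1 \<noteq> {}" "P2 \<noteq> {}" using P1 P2 P(2) by auto
  have \<Phi>_coset: "\<Phi> (P #>\<^bsub>G\<^esub> x) = (P1 #>\<^bsub>G1\<^esub> fst (\<psi> x), P2 #>\<^bsub>G2\<^esub> snd (\<psi> x))"
    if x: "x \<in> carrier G" for x
    unfolding \<Phi>_def coset[OF x] using ne by (auto simp: r_coset_def fst_image_times snd_image_times)
  have car: "\<psi> x \<in> carrier G1 \<times> carrier G2" if "x \<in> carrier G" for x
    using surj that by blast
  have sub: "P #>\<^bsub>G\<^esub> x \<subseteq> carrier G" if "x \<in> carrier G" for x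
    using P(1) closed that by (auto simp: r_coset_def)
  have "\<Phi> \<in> iso (G Mod P) ((G1 Mod P1) \<times>\<times> (G2 Mod P2))"
    unfolding iso_def bij_betw_def
  proof (intro CollectI conjI)
    show "\<Phi> \<in> hom (G Mod P) ((G1 Mod P1) \<times>\<times> (G2 Mod P2))"
    proof (rule homI)
      fix A assume "A \<in> carrier (G Mod P)"
      then obtain x where x: "x \<in> carrier G" "A = P #>\<^bsub>G\<^esub> x"
        by (auto simp: FactGroup_def RCOSETS_def)
      then show "\<Phi> A \<in> carrier ((G1 Mod P1) \<times>\<times> (G2 Mod P2))"
        using car[OF x(1)] by (auto simp: \<Phi>_coset FactGroup_def RCOSETS_def DirProd_def)
    next
      fix A B assume A: "A \<in> carrier (G Mod P)" and B: "B \<in> carrier (G Mod P)"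
      have s: "A \<subseteq> carrier G" "B \<subseteq> carrier G"
        using A B sub by (auto simp: FactGroup_def RCOSETS_def)
      have "fst ` \<psi> ` (A <#>\<^bsub>G\<^esub> B) = (fst ` \<psi> ` A) <#>\<^bsub>G1\<^esub> (fst ` \<psi> ` B)"
        "snd ` \<psi> ` (A <#>\<^bsub>G\<^esub> B) = (snd ` \<psi> ` A) <#>\<^bsub>G2\<^esub> (snd ` \<psi> ` B)"
        using s by (auto simp: set_mult_def image_UN fst_mult snd_mult subset_iff)
      then show "\<Phi> (A \<otimes>\<^bsub>G Mod P\<^esub> B) = \<Phi> A \<otimes>\<^bsub>(G1 Mod P1) \<times>\<times> (G2 Mod P2)\<^esub> \<Phi> B"
        by (simp add: \<Phi>_def FactGroup_def DirProd_def)
    qed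
  next
    show "inj_on \<Phi> (carrier (G Mod P))"
    proof (rule inj_onI)
      fix A B assume "A \<in> carrier (G Mod P)" "B \<in> carrier (G Mod P)" and eq: "\<Phi> A = \<Phi> B"
      then obtain x y where x: "x \<in> carrier G" "A = P #>\<^bsub>G\<^esub> x" and y: "y \<in> carrier G" "B = P #>\<^bsub>G\<^esub> y"
        by (auto simp: FactGroup_def RCOSETS_def)
      have "\<psi> ` A = \<psi> ` B"
        using eq by (simp add: x y \<Phi>_coset coset)
      then show "A = B"
        using inj_on_image_eq_iff[OF inj sub[OF x(1)] sub[OF y(1)]] by (simp add: x y)
    qed
  next
    show "\<Phi> ` carrier (G Mod P) = carrier ((G1 Mod P1) \<times>\<times> (G2 Mod P2))"
    proof
      show "\<Phi> ` carrier (G Mod P) \<subseteq> carrier ((G1 Mod P1) \<times>\<times> (G2 Mod P2))"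
        using car by (fastforce simp: \<Phi>_coset FactGroup_def RCOSETS_def DirProd_def)
      show "carrier ((G1 Mod P1) \<times>\<times> (G2 Mod P2)) \<subseteq> \<Phi> ` carrier (G Mod P)"
      proof
        fix z assume "z \<in> carrier ((G1 Mod P1) \<times>\<times> (G2 Mod P2))"
        then obtain x1 x2 where x: "x1 \<in> carrier G1" "x2 \<in> carrier G2"
          and z: "z = (P1 #>\<^bsub>G1\<^esub> x1, P2 #>\<^bsub>G2\<^esub> x2)"
          by (auto simp: FactGroup_def RCOSETS_def DirProd_def)
        obtain y where y: "y \<in> carrier G" "\<psi> y = (x1, x2)"
          using surj x by (metis (no_types, lifting) SigmaI imageE)
        have "z = \<Phi> (P #>\<^bsub>G\<^esub> y)" using y z by (simp add: \<Phi>_coset)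
        then show "z \<in> \<Phi> ` carrier (G Mod P)"
          using y(1) by (auto simp: FactGroup_def RCOSETS_def)
      qed
    qed
  qed
  then show ?thesis by (rule is_isoI)
qed

section \<open>Multiplicative subgroups of a field and their \<open>v\<close>-ideals\<close>

definition field_group :: "'k::field set \<Rightarrow> 'k monoid" where
  "field_group A = \<lparr>carrier = A, mult = (*), one = 1\<rparr>"

lemma field_group_set_mult [simp]: "I <#>\<^bsub>field_group A\<^esub> J = I * J"
  by (auto simp: set_mult_def field_group_def set_times_def)

lemma field_group_l_coset [simp]: "z <#\<^bsub>field_group A\<^esub> Y = z *o Y"
  by (auto simp: l_coset_def field_group_def elt_set_times_def)

lemma carrier_field_group [simp]: "carrier (field_group A) = A"
  by (simp add: field_group_def)

lemma set_times_nonempty: "I \<noteq> {} \<Longrightarrow> J \<noteq> {} \<Longrightarrow> I * J \<noteq> {}"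
  by (auto simp: set_times_def)

lemma set_times_commute: "(I :: 'a::ab_semigroup_mult set) * J = J * I"
  by (rule mult.commute)

lemma set_times_interchange: "(I * J) * (I' * J') = (I * I') * (J * (J' :: 'a::ab_semigroup_mult set))"
  by (simp only: mult_ac)

lemma set_times_mult_closed:
  fixes M N :: "'a::comm_monoid_mult set"
  assumes "\<And>x y. x \<in> M \<Longrightarrow> y \<in> M \<Longrightarrow> x * y \<in> M" "\<And>x y. x \<in> N \<Longrightarrow> y \<in> N \<Longrightarrow> x * y \<in> N"
    and "x \<in> M * N" "y \<in> M * N"
  shows "x * y \<in> M * N"
proof -
  obtain a b c d where *: "a \<in> M" "b \<in> N" "x = a * b" "c \<in> M" "d \<in> N" "y = c * d"
    using assms(3,4) by (auto elim!: set_times_elim)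
  have "x * y = (a * c) * (b * d)" by (simp add: * mult_ac)
  then show ?thesis using * assms(1,2) by auto
qed

text \<open>Together these axioms make \<open>A\<close> the quotient group of \<open>H\<close>,
  realised inside the multiplicative group of a field. In a common ambient field, intersections and
  setwise products of several such groups make sense.\<close>

locale fraction_monoid =
  fixes A H :: "'k::field set"
  assumes zero_notin: "0 \<notin> A"
    and mult_closed: "x \<in> A \<Longrightarrow> y \<in> A \<Longrightarrow> x * y \<in> A"
    and inverse_closed: "x \<in> A \<Longrightarrow> inverse x \<in> A"
    and H_subset: "H \<subseteq> A"
    and one_H: "1 \<in> H"
    and H_mult: "x \<in> H \<Longrightarrow> y \<in> H \<Longrightarrow> x * y \<in> H"
    and denominator: "x \<in> A \<Longrightarrow> \<exists>c\<in>H. c * x \<in> H"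
begin

abbreviation "vinv \<equiv> v_inverse (field_group A) H"
abbreviation "vcl \<equiv> v_closure (field_group A) H"
abbreviation "videals \<equiv> fractional_v_ideals (field_group A) H"
abbreviation "vgroup \<equiv> v_ideal_group (field_group A) H"
abbreviation "principals \<equiv> principal_ideals (field_group A) H"

lemma mem_vinv: "z \<in> vinv Y \<longleftrightarrow> z \<in> A \<and> (\<forall>y\<in>Y. z * y \<in> H)"
  by (auto simp: v_inverse_def elt_set_times_def)

lemma vinv_subset: "vinv Y \<subseteq> A"
  by (auto simp: mem_vinv)

lemma vcl_subset: "vcl Y \<subseteq> A"
  by (simp add: v_closure_def vinv_subset)

lemma subset_vcl:
  assumes "Y \<subseteq> A"
  shows "Y \<subseteq> vcl Y"
proof
  fix y assume y: "y \<in> Y"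
  have "y * z \<in> H" if "z \<in> vinv Y" for z
    using that y by (simp add: mem_vinv mult.commute[of y])
  then show "y \<in> vcl Y"
    using assms y unfolding v_closure_def mem_vinv[of y] by blast
qed

lemma vinv_antimono: "Y \<subseteq> Z \<Longrightarrow> vinv Z \<subseteq> vinv Y"
  unfolding mem_vinv subset_iff by blast

text \<open>\<open>vinv\<close> is the polarity of the symmetric relation
  \<open>z * y \<in> H\<close> on \<open>A\<close>, so a threefold inversion collapses to a single
  one: one inclusion is antitonicity applied to \<open>subset_vcl\<close>, the other is
  \<open>subset_vcl\<close> for the set \<open>vinv Y\<close>.\<close>

lemma vinv_vcl:
  assumes "Y \<subseteq> A"
  shows "vinv (vcl Y) = vinv Y"
proof
  show "vinv (vcl Y) \<subseteq> vinv Y"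
    using subset_vcl[OF assms] by (rule vinv_antimono)
  show "vinv Y \<subseteq> vinv (vcl Y)"
    using subset_vcl[OF vinv_subset] by (simp add: v_closure_def)
qed

lemma vcl_idem: "Y \<subseteq> A \<Longrightarrow> vcl (vcl Y) = vcl Y"
  using vinv_vcl[of Y] by (simp add: v_closure_def)

lemma vinv_H_closed: "h \<in> H \<Longrightarrow> z \<in> vinv Y \<Longrightarrow> h * z \<in> vinv Y"
  using H_subset by (auto simp: mem_vinv mult.assoc intro: mult_closed H_mult)

lemma vcl_H_closed: "h \<in> H \<Longrightarrow> z \<in> vcl Y \<Longrightarrow> h * z \<in> vcl Y"
  by (simp add: v_closure_def vinv_H_closed)

lemma mem_videals:
  "I \<in> videals \<longleftrightarrow> I \<subseteq> A \<and> I \<noteq> {} \<and> (\<exists>c\<in>H. c \<in> vinv I) \<and> vcl I = I"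
  using H_subset by (auto simp: fractional_v_ideals_def v_inverse_def)

lemma videals_H_closed: "I \<in> videals \<Longrightarrow> h \<in> H \<Longrightarrow> z \<in> I \<Longrightarrow> h * z \<in> I"
  by (metis mem_videals vcl_H_closed)

lemma times_H_closed:
  assumes "I \<in> videals" "h \<in> H" "x \<in> I * Y"
  shows "h * x \<in> I * Y"
proof -
  obtain i y where "i \<in> I" "y \<in> Y" "x = i * y"
    using assms(3) by (auto elim!: set_times_elim)
  then show ?thesis
    using set_times_intro[OF videals_H_closed[OF assms(1,2)]] by (simp add: mult.assoc)
qed

lemma vinv_times: "c \<in> vinv I \<Longrightarrow> e \<in> vinv J \<Longrightarrow> c * e \<in> vinv (I * J)"
  unfolding mem_vinv
proof (intro conjI ballI; elim conjE)
  fix y assume c: "\<forall>y\<in>I. c * y \<in> H" and e: "\<forall>y\<in>J. e * y \<in> H" and "y \<in> I * J"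
  then obtain i j where ij: "i \<in> I" "j \<in> J" "y = i * j" by (auto elim!: set_times_elim)
  have "(c * i) * (e * j) \<in> H" using c e ij by (simp add: H_mult)
  then show "c * e * y \<in> H" by (simp add: ij mult_ac)
qed (rule mult_closed)

text \<open>A common denominator of \<open>Y\<close> also serves its closure, because both have the
  same \<open>vinv\<close>.\<close>

lemma vcl_in_videals:
  assumes "Y \<subseteq> A" "Y \<noteq> {}" "c \<in> H" "c \<in> vinv Y"
  shows "vcl Y \<in> videals"
  using assms subset_vcl[of Y] unfolding mem_videals
  by (auto simp: vcl_idem vinv_vcl vcl_subset dest: subsetD[OF vcl_subset])

lemma times_subset: "I \<subseteq> A \<Longrightarrow> J \<subseteq> A \<Longrightarrow> I * J \<subseteq> A"
  by (auto elim!: set_times_elim intro: mult_closed)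

lemma videals_times:
  assumes I: "I \<in> videals" and J: "J \<in> videals"
  shows "vcl (I * J) \<in> videals"
proof -
  obtain c e where c: "c \<in> H" "c \<in> vinv I" "e \<in> H" "e \<in> vinv J"
    using I J by (auto simp: mem_videals)
  then show ?thesis
    using I J by (intro vcl_in_videals[of _ "c * e"] times_subset vinv_times H_mult set_times_nonempty)
      (simp_all add: mem_videals)
qed

lemma vinv_principal:
  assumes z: "z \<in> A"
  shows "vinv (z *o H) = inverse z *o H"
proof -
  have z0: "z \<noteq> 0" using z zero_notin by auto
  have "w \<in> inverse z *o H" if "w \<in> vinv (z *o H)" for w
  proof -
    have "w * z \<in> H" using that one_H by (auto simp: mem_vinv elt_set_times_def)
    moreover have "w = inverse z * (w * z)" using z0 by simp
    ultimately show ?thesis unfolding elt_set_times_def by blast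
  qed
  moreover have "inverse z * h \<in> vinv (z *o H)" if "h \<in> H" for h
    unfolding mem_vinv
  proof
    show "inverse z * h \<in> A" using that z H_subset by (auto intro: mult_closed inverse_closed)
    show "\<forall>y\<in>z *o H. inverse z * h * y \<in> H"
      using that z0 by (auto simp: elt_set_times_def field_simps intro: H_mult)
  qed
  ultimately show ?thesis by (auto simp: elt_set_times_def)
qed

text \<open>Inverting \<open>z *o H\<close> twice leads back to it, so it is closed; a denominator
  of \<open>z\<close> is a common denominator since \<open>H\<close> is closed under
  products.\<close>

lemma principals_subset: "principals \<subseteq> videals"
proof
  fix I assume "I \<in> principals"
  then obtain z where z: "z \<in> A" and I: "I = z *o H"
    by (auto simp: principal_ideals_def)
  obtain c where c: "c \<in> H" "c * z \<in> H" using denominator[OF z] by blast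
  have "c \<in> vinv I"
    using c H_subset H_mult by (auto simp: I mem_vinv elt_set_times_def mult.assoc[symmetric])
  moreover have "vcl I = I"
    unfolding v_closure_def I using z by (simp add: vinv_principal inverse_closed)
  ultimately show "I \<in> videals"
    using c(1) z H_subset one_H
    by (auto simp: mem_videals I elt_set_times_def intro: mult_closed)
qed

end

section \<open>Two monoids whose quotient groups meet in units only\<close>

text \<open>\<open>A1 \<inter> A2\<close> is closed under inverses, so by \<open>Int_subset\<close>
  its elements are units of both monoids. Thus \<open>A1 * A2\<close> is a direct product up to
  units, and the ambiguity disappears for ideals because they absorb units.\<close>

locale monoid_splitting =
  one: fraction_monoid A1 H1 + two: fraction_monoid A2 H2
  for A1 H1 A2 H2 :: "'k::field set" +
  assumes Int_subset: "A1 \<inter> A2 \<subseteq> H1 \<inter> H2"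
begin

lemma splitting_swap: "monoid_splitting A2 H2 A1 H1"
  by unfold_locales (use Int_subset in auto)

sublocale prod: fraction_monoid "A1 * A2" "H1 * H2"
proof
  show "0 \<notin> A1 * A2"
    using one.zero_notin two.zero_notin by (auto elim!: set_times_elim)
  show "x * y \<in> A1 * A2" if "x \<in> A1 * A2" "y \<in> A1 * A2" for x y
    using that set_times_mult_closed[OF one.mult_closed two.mult_closed] by blast
  show "inverse x \<in> A1 * A2" if "x \<in> A1 * A2" for x
    using that by (auto elim!: set_times_elim intro!: set_times_intro one.inverse_closed two.inverse_closed)
  show "H1 * H2 \<subseteq> A1 * A2"
    using one.H_subset two.H_subset by (rule set_times_mono2)
  show "1 \<in> H1 * H2"
    using set_times_intro[OF one.one_H two.one_H] by simp
  show "x * y \<in> H1 * H2" if "x \<in> H1 * H2" "y \<in> H1 * H2" for x y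
    using that set_times_mult_closed[OF one.H_mult two.H_mult] by blast
  show "\<exists>c\<in>H1 * H2. c * x \<in> H1 * H2" if x_in: "x \<in> A1 * A2" for x
  proof -
    obtain x1 x2 where x: "x1 \<in> A1" "x2 \<in> A2" "x = x1 * x2"
      using x_in by (auto elim!: set_times_elim)
    obtain c1 c2 where c: "c1 \<in> H1" "c1 * x1 \<in> H1" "c2 \<in> H2" "c2 * x2 \<in> H2"
      using one.denominator[OF x(1)] two.denominator[OF x(2)] by auto
    have "(c1 * c2) * x = (c1 * x1) * (c2 * x2)" by (simp add: x(3) mult_ac)
    then show ?thesis using c by (metis set_times_intro)
  qed
qed

text \<open>The quotient of \<open>x\<close> by \<open>x'\<close> equals that of \<open>y'\<close>
  by \<open>y\<close>, hence lies in both groups; factors in \<open>A1 * A2\<close> are therefore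
  determined up to units.\<close>

lemma factor_unique:
  assumes "x \<in> A1" "x' \<in> A1" "y \<in> A2" "y' \<in> A2" "x * y = x' * y'"
  obtains u where "u \<in> H1" "x = u * x'"
proof
  have nz: "x' \<noteq> 0" "y \<noteq> 0" using assms one.zero_notin two.zero_notin by auto
  have "x * inverse x' = y' * inverse y"
    using assms(5) nz by (simp add: field_simps)
  then have "x * inverse x' \<in> A1 \<inter> A2"
    using assms by (metis IntI one.inverse_closed one.mult_closed two.inverse_closed two.mult_closed)
  then show "x * inverse x' \<in> H1" using Int_subset by auto
  show "x = (x * inverse x') * x'" using nz by simp
qed

text \<open>By \<open>factor_unique\<close>, \<open>x\<close> is an \<open>H1\<close>-multiple of
  the first factor of any factorisation of \<open>x * y\<close> inside
  \<open>H1 * H2\<close>.\<close>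

lemma times_mem_H_left:
  assumes "x \<in> A1" "y \<in> A2" "x * y \<in> H1 * H2"
  shows "x \<in> H1"
proof -
  obtain h k where h: "h \<in> H1" "k \<in> H2" "x * y = h * k"
    using assms(3) by (auto elim!: set_times_elim)
  then obtain u where "u \<in> H1" "x = u * h"
    using assms one.H_subset two.H_subset by (metis factor_unique subsetD)
  then show ?thesis using h by (simp add: one.H_mult)
qed

text \<open>Factors are unique only up to units, so there is no projection on elements; for a set,
  all possible first factors are collected.\<close>

definition proj :: "'k set \<Rightarrow> 'k set" where
  "proj Y = {x \<in> A1. \<exists>y\<in>A2. x * y \<in> Y}"

text \<open>Closure of \<open>X\<close> under \<open>H1\<close> absorbs the ambiguity of first
  factors, and any member of \<open>Y\<close> is a cofactor for every element of
  \<open>X\<close>.\<close>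

lemma proj_times:
  assumes "X \<subseteq> A1" "Y \<subseteq> A2" "Y \<noteq> {}" "\<And>h x. h \<in> H1 \<Longrightarrow> x \<in> X \<Longrightarrow> h * x \<in> X"
  shows "proj (X * Y) = X"
proof
  show "proj (X * Y) \<subseteq> X"
  proof
    fix x assume "x \<in> proj (X * Y)"
    then obtain y x' y' where "x \<in> A1" "y \<in> A2" "x' \<in> X" "y' \<in> Y" "x * y = x' * y'"
      by (auto simp: proj_def elim!: set_times_elim)
    then show "x \<in> X" using assms by (metis factor_unique subsetD)
  qed
  show "X \<subseteq> proj (X * Y)"
    using assms by (auto simp: proj_def set_times_def)
qed

text \<open>Second components are first components of the mirrored splitting, so facts about
  \<open>proj\<close> transfer to \<open>proj2\<close> up to commuting the products.\<close>

interpretation swap: monoid_splitting A2 H2 A1 H1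
  by (rule splitting_swap)

abbreviation proj2 :: "'k set \<Rightarrow> 'k set" where
  "proj2 \<equiv> swap.proj"

lemma proj2_times:
  assumes "X \<subseteq> A1" "Y \<subseteq> A2" "X \<noteq> {}" "\<And>h x. h \<in> H2 \<Longrightarrow> x \<in> Y \<Longrightarrow> h * x \<in> Y"
  shows "proj2 (X * Y) = Y"
  using swap.proj_times[of Y X] assms by (simp add: mult.commute)

text \<open>The product of \<open>z1 * z2\<close> and \<open>y1 * y2\<close> regroups as
  \<open>(z1 * y1) * (z2 * y2)\<close>, which lies in \<open>H1 * H2\<close> exactly when each
  factor lies in its own monoid.\<close>

lemma vinv_eq:
  assumes Y: "Y \<subseteq> A1 * A2"
  shows "prod.vinv Y = one.vinv (proj Y) * two.vinv (proj2 Y)"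
proof
  show "prod.vinv Y \<subseteq> one.vinv (proj Y) * two.vinv (proj2 Y)"
  proof
    fix z assume z: "z \<in> prod.vinv Y"
    then obtain z1 z2 where z12: "z1 \<in> A1" "z2 \<in> A2" "z = z1 * z2"
      by (auto simp: prod.mem_vinv elim!: set_times_elim)
    have *: "(z1 * y1) * (z2 * y2) \<in> H1 * H2" if "y1 * y2 \<in> Y" for y1 y2
      using z that by (auto simp: prod.mem_vinv z12 mult_ac)
    have "z1 \<in> one.vinv (proj Y)"
      unfolding one.mem_vinv proj_def
    proof (intro conjI ballI, goal_cases)
      case (2 y)
      then obtain x where x: "y \<in> A1" "x \<in> A2" "y * x \<in> Y" by auto
      show ?case
        using *[of y x] x z12
        by (intro times_mem_H_left[of _ "z2 * x"]) (auto intro: one.mult_closed two.mult_closed)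
    qed (use z12 in auto)
    moreover have "z2 \<in> two.vinv (proj2 Y)"
      unfolding two.mem_vinv swap.proj_def
    proof (intro conjI ballI, goal_cases)
      case (2 y)
      then obtain x where x: "x \<in> A1" "y \<in> A2" "y * x \<in> Y" by auto
      show ?case
        using *[of x y] x z12
        by (intro swap.times_mem_H_left[of _ "z1 * x"])
          (auto simp: set_times_commute[of H2] mult.commute intro: one.mult_closed two.mult_closed)
    qed (use z12 in auto)
    ultimately show "z \<in> one.vinv (proj Y) * two.vinv (proj2 Y)"
      unfolding z12(3) by (rule set_times_intro)
  qed
  show "one.vinv (proj Y) * two.vinv (proj2 Y) \<subseteq> prod.vinv Y"
  proof
    fix z assume "z \<in> one.vinv (proj Y) * two.vinv (proj2 Y)"
    then obtain z1 z2 where z: "z1 \<in> one.vinv (proj Y)" "z2 \<in> two.vinv (proj2 Y)" "z = z1 * z2"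
      by (auto elim!: set_times_elim)
    show "z \<in> prod.vinv Y"
      unfolding prod.mem_vinv
    proof (intro conjI ballI)
      show "z \<in> A1 * A2" using z by (auto simp: one.mem_vinv two.mem_vinv)
      fix y assume y: "y \<in> Y"
      then obtain y1 y2 where y12: "y1 \<in> A1" "y2 \<in> A2" "y = y1 * y2"
        using Y by (blast elim!: set_times_elim)
      have "y1 \<in> proj Y" "y2 \<in> proj2 Y"
        using y y12 by (auto simp: proj_def swap.proj_def mult.commute)
      then have "z1 * y1 \<in> H1" "z2 * y2 \<in> H2"
        using z by (auto simp: one.mem_vinv two.mem_vinv)
      then have "(z1 * y1) * (z2 * y2) \<in> H1 * H2" by (rule set_times_intro)
      then show "z * y \<in> H1 * H2" by (simp add: z(3) y12(3) mult_ac)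
    qed
  qed
qed

text \<open>This is \<open>vinv_eq\<close> applied twice. Nonemptiness of \<open>prod.vinv Y\<close>
  makes both of its factors nonempty, so that projecting their product gives them back.\<close>

lemma vcl_eq:
  assumes Y: "Y \<subseteq> A1 * A2" and "prod.vinv Y \<noteq> {}"
  shows "prod.vcl Y = one.vcl (proj Y) * two.vcl (proj2 Y)"
proof -
  let ?V = "one.vinv (proj Y)" and ?W = "two.vinv (proj2 Y)"
  have eq: "prod.vinv Y = ?V * ?W" by (rule vinv_eq[OF Y])
  then have "?V \<noteq> {}" "?W \<noteq> {}" using assms(2) by (auto simp: set_times_def)
  then have "proj (?V * ?W) = ?V" "proj2 (?V * ?W) = ?W"
    by (simp_all add: proj_times proj2_times one.vinv_subset two.vinv_subset one.vinv_H_closed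
        two.vinv_H_closed)
  then show ?thesis
    using vinv_eq[OF prod.vinv_subset, of Y] by (simp add: v_closure_def eq)
qed

lemma proj_vcl:
  assumes Y: "Y \<subseteq> A1 * A2" "Y \<noteq> {}" and "prod.vinv Y \<noteq> {}"
  shows "proj (prod.vcl Y) = one.vcl (proj Y)" "proj2 (prod.vcl Y) = two.vcl (proj2 Y)"
proof -
  obtain y1 y2 where "y1 \<in> A1" "y2 \<in> A2" "y1 * y2 \<in> Y"
    using Y by (blast elim!: set_times_elim)
  then have "y1 \<in> proj Y" "y2 \<in> proj2 Y"
    by (auto simp: proj_def swap.proj_def mult.commute)
  moreover have "proj Y \<subseteq> A1" "proj2 Y \<subseteq> A2"
    by (auto simp: proj_def swap.proj_def)
  ultimately have "one.vcl (proj Y) \<noteq> {}" "two.vcl (proj2 Y) \<noteq> {}"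
    using one.subset_vcl two.subset_vcl by blast+
  then show "proj (prod.vcl Y) = one.vcl (proj Y)" "proj2 (prod.vcl Y) = two.vcl (proj2 Y)"
    unfolding vcl_eq[OF Y(1) assms(3)]
    by (simp_all add: proj_times proj2_times one.vcl_subset two.vcl_subset one.vcl_H_closed
        two.vcl_H_closed)
qed

lemma videal_proj:
  assumes I: "I \<in> prod.videals"
  shows "proj I \<in> one.videals" "proj2 I \<in> two.videals" "proj I * proj2 I = I"
proof -
  have IA: "I \<subseteq> A1 * A2" "I \<noteq> {}" "prod.vinv I \<noteq> {}" "prod.vcl I = I"
    using I by (auto simp: prod.mem_videals)
  have cl: "one.vcl (proj I) = proj I" "two.vcl (proj2 I) = proj2 I"
    using proj_vcl[OF IA(1-3)] IA(4) by auto
  \<comment> \<open>A common denominator of \<open>I\<close> splits along \<open>vinv_eq\<close>;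
    since it lies in \<open>H1 * H2\<close>, its two factors lie in \<open>H1\<close> and
    \<open>H2\<close> and are common denominators of the projections.\<close>
  obtain c where c: "c \<in> H1 * H2" "c \<in> prod.vinv I"
    using I by (auto simp: prod.mem_videals)
  obtain c1 c2 where c12: "c1 \<in> one.vinv (proj I)" "c2 \<in> two.vinv (proj2 I)" "c = c1 * c2"
    using c(2) unfolding vinv_eq[OF IA(1)] by (auto elim!: set_times_elim)
  have "c1 \<in> A1" "c2 \<in> A2" using c12 by (auto simp: one.mem_vinv two.mem_vinv)
  then have "c1 \<in> H1" "c2 \<in> H2"
    using c(1) times_mem_H_left[of c1 c2] swap.times_mem_H_left[of c2 c1]
    by (auto simp: c12(3) mult.commute)
  moreover obtain y1 y2 where "y1 \<in> A1" "y2 \<in> A2" "y1 * y2 \<in> I"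
    using IA by (blast elim!: set_times_elim)
  then have "y1 \<in> proj I" "y2 \<in> proj2 I"
    by (auto simp: proj_def swap.proj_def mult.commute)
  ultimately show "proj I \<in> one.videals" "proj2 I \<in> two.videals"
    unfolding one.mem_videals two.mem_videals using c12 cl
    by (auto simp: proj_def swap.proj_def)
  show "proj I * proj2 I = I"
    using vcl_eq[OF IA(1,3)] cl IA(4) by simp
qed

lemma proj_videals_times:
  assumes "I \<in> one.videals" "J \<in> two.videals"
  shows "proj (I * J) = I" "proj2 (I * J) = J"
  using assms one.videals_H_closed[OF assms(1)] two.videals_H_closed[OF assms(2)]
  by (simp_all add: proj_times proj2_times one.mem_videals two.mem_videals)

lemma videal_times:
  assumes I: "I \<in> one.videals" and J: "J \<in> two.videals"
  shows "I * J \<in> prod.videals"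
proof -
  obtain c e where c: "c \<in> H1" "c \<in> one.vinv I" "e \<in> H2" "e \<in> two.vinv J"
    using I J by (auto simp: one.mem_videals two.mem_videals)
  have sub: "I * J \<subseteq> A1 * A2"
    using I J by (intro set_times_mono2) (auto simp: one.mem_videals two.mem_videals)
  have ce: "c * e \<in> prod.vinv (I * J)"
    unfolding vinv_eq[OF sub] proj_videals_times[OF I J] using c by auto
  have "prod.vcl (I * J) = I * J"
    using I J vcl_eq[OF sub] ce unfolding proj_videals_times[OF I J]
    by (auto simp: one.mem_videals two.mem_videals)
  moreover have "I * J \<noteq> {}"
    using I J by (intro set_times_nonempty) (auto simp: one.mem_videals two.mem_videals)
  moreover have "c * e \<in> H1 * H2" using c by auto
  ultimately show ?thesis
    unfolding prod.mem_videals using sub ce by blast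
qed

text \<open>Writing both ideals as products of their projections turns \<open>I * J\<close> into a
  subset of \<open>A1\<close> times a subset of \<open>A2\<close>, whose projections can be read
  off; \<open>proj_vcl\<close> then handles the closure. This is the homomorphism property of the
  two projections.\<close>

lemma proj_vcl_times:
  assumes I: "I \<in> prod.videals" and J: "J \<in> prod.videals"
  shows "proj (prod.vcl (I * J)) = one.vcl (proj I * proj J)"
    "proj2 (prod.vcl (I * J)) = two.vcl (proj2 I * proj2 J)"
proof -
  note I' = videal_proj[OF I] and J' = videal_proj[OF J]
  have IA: "I \<subseteq> A1 * A2" "I \<noteq> {}" and JA: "J \<subseteq> A1 * A2" "J \<noteq> {}"
    using I J by (auto simp: prod.mem_videals)
  obtain c e where "c \<in> prod.vinv I" "e \<in> prod.vinv J"
    using I J by (auto simp: prod.mem_videals)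
  then have ne: "prod.vinv (I * J) \<noteq> {}" using prod.vinv_times by blast
  have IJ: "I * J = (proj I * proj J) * (proj2 I * proj2 J)"
    using set_times_interchange[of "proj I" "proj2 I" "proj J" "proj2 J"] by (simp only: I'(3) J'(3))
  have 1: "proj I * proj J \<subseteq> A1" "proj2 I * proj2 J \<subseteq> A2"
    "proj I * proj J \<noteq> {}" "proj2 I * proj2 J \<noteq> {}"
    using I' J'
    by (simp_all add: one.mem_videals two.mem_videals set_times_nonempty
        one.times_subset two.times_subset)
  have 4: "proj (I * J) = proj I * proj J" "proj2 (I * J) = proj2 I * proj2 J"
    using 1 one.times_H_closed[OF I'(1)] two.times_H_closed[OF I'(2)]
    by (simp_all add: IJ proj_times proj2_times)
  have 5: "I * J \<subseteq> A1 * A2" "I * J \<noteq> {}"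
    using IA JA by (simp_all add: prod.times_subset set_times_nonempty)
  show "proj (prod.vcl (I * J)) = one.vcl (proj I * proj J)"
    "proj2 (prod.vcl (I * J)) = two.vcl (proj2 I * proj2 J)"
    using proj_vcl[OF 5 ne] unfolding 4 .
qed

text \<open>Taking both projections and multiplying two ideals are inverse to each other on
  \<open>v\<close>-ideals, and the principal ideal of \<open>z1 * z2\<close> corresponds to those of
  \<open>z1\<close> and \<open>z2\<close>; so \<open>FactGroup_product_iso\<close> applies.\<close>

theorem v_class_group_iso:
  "v_class_group (field_group (A1 * A2)) (H1 * H2) \<cong>
     v_class_group (field_group A1) H1 \<times>\<times> v_class_group (field_group A2) H2"
proof -
  let ?\<psi> = "\<lambda>I. (proj I, proj2 I)"
  have inv: "?\<psi> (I * J) = (I, J)" if "I \<in> one.videals" "J \<in> two.videals" for I J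
    using proj_videals_times[OF that] by simp
  have car: "carrier prod.vgroup = prod.videals" "carrier one.vgroup = one.videals"
    "carrier two.vgroup = two.videals"
    by (simp_all add: v_ideal_group_def)
  have "1 \<in> A1" "1 \<in> A2" using one.H_subset two.H_subset one.one_H two.one_H by auto
  have pr: "?\<psi> ((z1 * z2) *o (H1 * H2)) = (z1 *o H1, z2 *o H2)"
    if z: "z1 \<in> A1" "z2 \<in> A2" for z1 z2
  proof -
    have "(z1 * z2) *o (H1 * H2) = (z1 *o H1) * (z2 *o H2)"
      by (rule set_times_rearrange[symmetric])
    moreover have "z1 *o H1 \<in> one.videals" "z2 *o H2 \<in> two.videals"
      using z one.principals_subset two.principals_subset by (auto simp: principal_ideals_def)
    ultimately show ?thesis using inv by simp
  qed
  show ?thesis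
    unfolding v_class_group_def
  proof (rule FactGroup_product_iso[where \<psi> = ?\<psi>])
    show "?\<psi> \<in> hom prod.vgroup (one.vgroup \<times>\<times> two.vgroup)"
      by (rule homI) (auto simp: car DirProd_def videal_proj v_ideal_group_def proj_vcl_times)
    show "inj_on ?\<psi> (carrier prod.vgroup)"
      unfolding car by (rule inj_onI) (metis Pair_inject videal_proj(3))
    show "?\<psi> ` carrier prod.vgroup = carrier one.vgroup \<times> carrier two.vgroup"
      unfolding car
    proof (intro equalityI subsetI)
      fix p assume "p \<in> one.videals \<times> two.videals"
      then obtain I J where p: "p = (I, J)" and IJ: "I \<in> one.videals" "J \<in> two.videals"
        by blast
      show "p \<in> ?\<psi> ` prod.videals"
        unfolding p inv[OF IJ, symmetric] by (rule imageI) (rule videal_times[OF IJ])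
    qed (auto simp: videal_proj)
    show "prod.principals \<subseteq> carrier prod.vgroup"
      unfolding car by (rule prod.principals_subset)
    show "prod.principals \<noteq> {}"
      using \<open>1 \<in> A1\<close> \<open>1 \<in> A2\<close> by (auto simp: principal_ideals_def set_times_def)
    show "?\<psi> ` prod.principals = one.principals \<times> two.principals"
    proof (intro equalityI subsetI)
      fix p assume "p \<in> ?\<psi> ` prod.principals"
      then obtain z1 z2 where "z1 \<in> A1" "z2 \<in> A2" "p = ?\<psi> ((z1 * z2) *o (H1 * H2))"
        by (auto simp: principal_ideals_def elim!: set_times_elim)
      then show "p \<in> one.principals \<times> two.principals"
        using pr[of z1 z2] by (auto simp: principal_ideals_def)
    next
      fix p assume "p \<in> one.principals \<times> two.principals"
      then obtain z1 z2 where z: "z1 \<in> A1" "z2 \<in> A2" "p = (z1 *o H1, z2 *o H2)"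
        by (auto simp: principal_ideals_def)
      then have "(z1 * z2) *o (H1 * H2) \<in> prod.principals"
        by (auto simp: principal_ideals_def)
      then show "p \<in> ?\<psi> ` prod.principals"
        unfolding z(3) pr[OF z(1,2), symmetric] by (rule imageI)
    qed
    show "I \<otimes>\<^bsub>prod.vgroup\<^esub> J \<in> carrier prod.vgroup"
      if "I \<in> carrier prod.vgroup" "J \<in> carrier prod.vgroup" for I J
      using that prod.videals_times unfolding car by (simp add: v_ideal_group_def)
  qed
qed

end

section \<open>Comaximal polynomials and a form of Gauss's lemma\<close>

definition comaximal :: "'r::comm_ring_1 \<Rightarrow> 'r \<Rightarrow> bool" where
  "comaximal p q \<longleftrightarrow> (\<exists>a b. a * p + b * q = 1)"

lemma comaximal_commute: "comaximal p q \<longleftrightarrow> comaximal q p"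
  unfolding comaximal_def by (metis add.commute)

lemma comaximal_dvd_mult:
  assumes "comaximal p q" "p dvd q * t"
  shows "p dvd t"
proof -
  obtain a b where "a * p + b * q = 1" using assms(1) by (auto simp: comaximal_def)
  then have "t = a * p * t + b * (q * t)"
    by (metis distrib_right mult.assoc mult_1)
  then show ?thesis using assms(2) by (metis dvd_add dvd_mult dvd_mult2 dvd_triv_right)
qed

lemma comaximal_mult:
  assumes "comaximal p q" "comaximal p q'"
  shows "comaximal p (q * q')"
proof -
  obtain a b a' b' where *: "a * p + b * q = 1" "a' * p + b' * q' = 1"
    using assms by (auto simp: comaximal_def)
  have "(a * p + b * q) * (a' * p + b' * q') = 1" by (simp add: *)
  then have "(a * a' * p + a * b' * q' + b * q * a') * p + (b * b') * (q * q') = 1"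
    by (simp add: algebra_simps)
  then show ?thesis unfolding comaximal_def by blast
qed

lemma comaximal_power: "comaximal p q \<Longrightarrow> comaximal p (q ^ n)"
proof (induction n)
  case 0
  have "0 * p + 1 * 1 = 1" by simp
  then show ?case unfolding comaximal_def by (metis power_0)
qed (simp add: comaximal_mult)

lemma comaximal_dvd_right:
  assumes "comaximal p q" "r dvd q"
  shows "comaximal p r"
proof -
  obtain a b t where "a * p + b * q = 1" "q = r * t"
    using assms by (auto simp: comaximal_def)
  then have "a * p + (b * t) * r = 1" by (simp add: mult_ac)
  then show ?thesis unfolding comaximal_def by blast
qed

lemma comaximal_dvd_powers:
  assumes "comaximal p q" "r dvd p ^ m" "s dvd q ^ n"
  shows "comaximal r s"
  using assms comaximal_power comaximal_commute comaximal_dvd_right by metis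

text \<open>A nonzero element of least degree in the ideal generated by \<open>p\<close> and
  \<open>q\<close> divides every element of it, since the remainder of a division lies in the ideal
  and has smaller degree if it is nonzero.\<close>

lemma field_poly_bezout:
  fixes p q :: "'k::field poly"
  obtains d a b where "d dvd p" "d dvd q" "d = a * p + b * q"
proof (cases "p = 0 \<and> q = 0")
  case True
  then show ?thesis using that[of 0 0 0] by simp
next
  case False
  define S where "S = {a * p + b * q | a b. True}"
  have "p = 1 * p + 0 * q" "q = 0 * p + 1 * q" by simp_all
  then have pq: "p \<in> S" "q \<in> S" unfolding S_def by blast+
  then have "\<exists>m. m \<in> S \<and> m \<noteq> 0" using False by blast
  then obtain m where m: "m \<in> S" "m \<noteq> 0"
    and least: "\<And>t. t \<in> S \<Longrightarrow> t \<noteq> 0 \<Longrightarrow> degree m \<le> degree t"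
    using ex_has_least_nat[of "\<lambda>m. m \<in> S \<and> m \<noteq> 0" _ degree] by blast
  obtain a b where ab: "m = a * p + b * q" using m(1) by (auto simp: S_def)
  have "m dvd t" if t: "t \<in> S" for t
  proof -
    obtain a' b' where "t = a' * p + b' * q" using t by (auto simp: S_def)
    then have "t mod m = (a' - (t div m) * a) * p + (b' - (t div m) * b) * q"
      using ab by (simp add: minus_div_mult_eq_mod[symmetric] algebra_simps)
    then have "t mod m \<in> S" unfolding S_def by blast
    then show ?thesis
      using least[of "t mod m"] degree_mod_less'[of m t] m(2) unfolding dvd_eq_mod_eq_0 by linarith
  qed
  then show ?thesis using that ab pq by blast
qed

section \<open>Descent of factorisations from the quotient field to the base ring\<close>

lemma fract_cases:
  obtains x y where "c = to_fract x / to_fract y" "y \<noteq> 0"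
  by (cases c) (simp add: Fract_conv_to_fract)

lemma clear_denominators:
  fixes h :: "'a::idom fract poly"
  shows "\<exists>b p. b \<noteq> 0 \<and> smult (to_fract b) h = fract_poly p"
proof (induction h)
  case 0
  show ?case by (intro exI[of _ 1] exI[of _ 0]) simp
next
  case (pCons c h)
  obtain b p where b: "b \<noteq> 0" "smult (to_fract b) h = fract_poly p" using pCons by blast
  obtain x y where c: "c = to_fract x / to_fract y" "y \<noteq> 0" by (rule fract_cases)
  have "smult (to_fract (y * b)) (pCons c h) = fract_poly (pCons (x * b) (smult y p))"
    using c b by (simp add: map_poly_pCons mult.commute flip: b(2))
  then show ?case using b c by (metis mult_eq_0_iff)
qed

text \<open>A prime of the base ring stays prime as a constant polynomial, so it can be cancelled
  from one of the two factors.\<close>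

lemma const_prime_cases:
  fixes r t :: "'a::idom poly"
  assumes p: "prime_elem p" and eq: "smult (p * x) q = r * t"
  obtains r' where "r = smult p r'" "smult x q = r' * t"
  | t' where "t = smult p t'" "smult x q = r * t'"
proof -
  have p0: "p \<noteq> 0" using p by auto
  have "r * t = [:p:] * smult x q" using eq by (simp add: mult.commute)
  then have "[:p:] dvd r * t" by (metis dvd_triv_left)
  then have "[:p:] dvd r \<or> [:p:] dvd t"
    using lift_prime_elem_poly[OF p] by (simp add: prime_elem_dvd_mult_iff)
  then show ?thesis
  proof
    assume "[:p:] dvd r"
    then obtain s where "r = [:p:] * s" by (rule dvdE)
    then have s: "r = smult p s" by simp
    have "smult x q = s * t"
      using eq p0 unfolding s by - (rule smult_cancel[OF p0], simp)
    with s show ?thesis by (rule that(1))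
  next
    assume "[:p:] dvd t"
    then obtain s where "t = [:p:] * s" by (rule dvdE)
    then have s: "t = smult p s" by simp
    have "smult x q = r * s"
      using eq p0 unfolding s by - (rule smult_cancel[OF p0], simp)
    with s show ?thesis by (rule that(2))
  qed
qed

text \<open>
  Contents are not available over a \<^class>\<open>factorial_semiring\<close>, which has no gcd operation, so
  denominators are cleared one prime at a time.
\<close>

lemma smult_factor:
  fixes q r t :: "'a::{factorial_semiring,idom} poly"
  assumes "b \<noteq> 0" "smult b q = r * t"
  shows "\<exists>r' c e. r' dvd q \<and> c \<noteq> 0 \<and> e \<noteq> 0 \<and> smult c r = smult e r'"
  using assms
proof (induction b arbitrary: r t rule: prime_divisors_induct)
  case (unit b)
  then obtain b' where b': "1 = b * b'" by (auto elim: dvdE)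
  have "q = smult (b * b') q" by (simp flip: b')
  also have "\<dots> = smult b' r * t" using unit by (simp add: mult.commute[of b] flip: smult_smult)
  finally have "smult b' r dvd q" by (metis dvd_triv_left)
  then show ?case using b' by (intro exI[of _ "smult b' r"] exI[of _ b'] exI[of _ 1]) auto
next
  case (factor p b)
  have p: "prime_elem p" "p \<noteq> 0" "b \<noteq> 0" using factor by auto
  from p(1) factor.prems(2) show ?case
  proof (cases rule: const_prime_cases)
    case (1 s)
    obtain r' c e where *: "r' dvd q" "c \<noteq> 0" "e \<noteq> 0" "smult c s = smult e r'"
      using factor.IH[OF p(3) 1(2)] by blast
    \<comment> \<open>The prime cancelled from \<open>r\<close> is restored in the scalar
      \<open>e\<close>; in the other case it is cancelled from \<open>t\<close> and \<open>r\<close>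
      stays unchanged.\<close>
    have "smult c r = smult p (smult c s)" by (simp add: 1(1) mult.commute)
    then have "smult c r = smult (p * e) r'" by (simp add: *(4))
    then show ?thesis using * p by (intro exI[of _ r'] exI[of _ c] exI[of _ "p * e"]) simp
  next
    case (2 s)
    then show ?thesis using factor.IH[OF p(3) 2(2)] by blast
  qed
qed simp

text \<open>Gauss's lemma: clearing the denominators of \<open>r\<close> and its cofactor gives a
  factorisation of a constant multiple of \<open>q\<close> over the base ring, to which
  \<open>smult_factor\<close> applies.\<close>

lemma fract_poly_factor_lift:
  fixes q :: "'a::{factorial_semiring,idom} poly"
  assumes "r dvd fract_poly q"
  obtains r0 c where "r0 dvd q" "c \<noteq> 0" "r = smult c (fract_poly r0)"
proof -
  obtain t where t: "fract_poly q = r * t" using assms by (auto elim: dvdE)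
  obtain b r1 where r1: "b \<noteq> 0" "smult (to_fract b) r = fract_poly r1"
    using clear_denominators by blast
  obtain b' t1 where t1: "b' \<noteq> 0" "smult (to_fract b') t = fract_poly t1"
    using clear_denominators by blast
  have "fract_poly (smult (b * b') q) = smult (to_fract b) r * smult (to_fract b') t"
    by (simp add: t mult_ac)
  then have "fract_poly (smult (b * b') q) = fract_poly (r1 * t1)"
    by (simp only: r1(2) t1(2) fract_poly_mult)
  then have "smult (b * b') q = r1 * t1" by (simp only: fract_poly_eq_iff)
  then obtain r' c e where *: "r' dvd q" "c \<noteq> 0" "e \<noteq> 0" "smult c r1 = smult e r'"
    using smult_factor[of "b * b'" q r1 t1] r1 t1 by auto
  have "smult (to_fract (c * b)) r = smult (to_fract e) (fract_poly r')"
    using arg_cong[OF *(4), of fract_poly] by (simp flip: r1(2))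
  then have "smult (inverse (to_fract (c * b))) (smult (to_fract (c * b)) r) =
      smult (inverse (to_fract (c * b)) * to_fract e) (fract_poly r')"
    by simp
  then have "r = smult (inverse (to_fract (c * b)) * to_fract e) (fract_poly r')"
    using *(2) r1(1) unfolding smult_smult by (simp del: to_fract_mult)
  moreover have "inverse (to_fract (c * b)) * to_fract e \<noteq> 0"
    using * r1(1) by simp
  ultimately show ?thesis using that *(1) by blast
qed

text \<open>The primes of \<open>x\<close> are cancelled one by one, each from \<open>y\<close> or
  from \<open>n\<close>; the latter replaces \<open>n\<close> by a divisor of it. Once
  \<open>x\<close> is a unit, \<open>n\<close> divides \<open>m\<close> and hence \<open>f\<close>,
  and the degrees agree unless \<open>m\<close> is zero.\<close>

lemma common_divisor_of_proportional:
  fixes f g m n :: "'a::{factorial_semiring,idom} poly"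
  assumes "x \<noteq> 0" "smult x m = smult y n" "m dvd f" "n dvd g"
  shows "\<exists>d. d dvd f \<and> d dvd g \<and> degree d = degree m"
  using assms
proof (induction x arbitrary: y n rule: prime_divisors_induct)
  case (unit x)
  then obtain x' where x': "1 = x * x'" by (auto elim: dvdE)
  have "m = smult (x * x') m" by (simp flip: x')
  also have "\<dots> = smult (x' * y) n"
    using unit by (simp add: mult.commute[of x] flip: smult_smult)
  finally have m: "m = smult (x' * y) n" .
  then have "n dvd m" by (simp add: dvd_smult)
  then have "n dvd f" using unit(4) by (rule dvd_trans)
  show ?case
  proof (cases "x' * y = 0")
    case True
    then have "m = 0" using m by simp
    \<comment> \<open>The zero polynomial has degree 0 by convention, so the divisor 1 has the
      required degree.\<close>
    then show ?thesis using unit by (intro exI[of _ 1]) auto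
  next
    case False
    then have "degree n = degree m" using m by simp
    then show ?thesis using \<open>n dvd f\<close> unit by blast
  qed
next
  case (factor p x)
  have p: "prime_elem p" "p \<noteq> 0" "x \<noteq> 0" using factor by auto
  \<comment> \<open>The scalar \<open>y\<close> is read as a constant polynomial so that
    \<open>const_prime_cases\<close> decides whether \<open>p\<close> divides \<open>y\<close> or
    \<open>n\<close>.\<close>
  have "smult (p * x) m = [:y:] * n" using factor by simp
  with p(1) show ?case
  proof (cases rule: const_prime_cases)
    case (1 c)
    then have "degree c = 0" using p(2) by (metis degree_pCons_0 degree_smult_eq 1(1))
    then obtain z where "c = [:z:]" by (rule degree_eq_zeroE)
    then have "smult x m = smult z n" using 1 by simp
    then show ?thesis using factor.IH[OF p(3) _ factor.prems(3,4)] by blast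
  next
    case (2 n')
    then have "smult x m = smult y n'" by simp
    moreover have "n' dvd g"
      using factor.prems(4) unfolding 2(1) by (rule dvd_trans[OF dvd_smult[OF dvd_refl]])
    ultimately show ?thesis using factor.IH[OF p(3) _ factor.prems(3)] by blast
  qed
qed simp

text \<open>The Bezout element over the field is a common divisor; it descends to divisors
  \<open>m\<close> of \<open>f\<close> and \<open>n\<close> of \<open>g\<close> that are
  proportional, hence to a common divisor of the same degree over the base ring. By
  \<open>gcd\<close> that degree is 0, so the Bezout element is a nonzero constant and can be scaled
  to 1.\<close>

lemma comaximal_fract_poly:
  fixes f g :: "'a::{factorial_semiring,idom} poly"
  assumes gcd: "GCD_set f g = {u. u dvd 1}" and f: "f \<noteq> 0"
  shows "comaximal (fract_poly f) (fract_poly g)"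
proof -
  obtain d a b where d: "d dvd fract_poly f" "d dvd fract_poly g"
    and bezout: "d = a * fract_poly f + b * fract_poly g"
    by (rule field_poly_bezout)
  obtain m c where m: "m dvd f" "c \<noteq> 0" "d = smult c (fract_poly m)"
    using d(1) by (rule fract_poly_factor_lift)
  obtain n e where n: "n dvd g" "e \<noteq> 0" "d = smult e (fract_poly n)"
    using d(2) by (rule fract_poly_factor_lift)
  obtain x y where x: "c / e = to_fract x / to_fract y" "y \<noteq> 0" by (rule fract_cases)
  have "x \<noteq> 0" using x(1) m(2) n(2) by auto
  have "c * to_fract y = e * to_fract x" using x n(2) by (simp add: field_simps)
  then have "smult (e * to_fract x) (fract_poly m) = smult (to_fract y) d"
    by (simp add: m(3) mult.commute)
  then have "smult (e * to_fract x) (fract_poly m) = smult (e * to_fract y) (fract_poly n)"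
    by (simp add: n(3) mult.commute)
  then have "fract_poly (smult x m) = fract_poly (smult y n)"
    using n(2) by - (rule smult_cancel[of e], simp_all)
  then have "smult x m = smult y n" by (simp only: fract_poly_eq_iff)
  then obtain k where k: "k dvd f" "k dvd g" "degree k = degree m"
    using common_divisor_of_proportional \<open>x \<noteq> 0\<close> m(1) n(1) by blast
  \<comment> \<open>Since 1 is a greatest common divisor, every common divisor is a unit.\<close>
  have "1 \<in> GCD_set f g" using gcd by simp
  then have "k dvd 1" using k by (auto simp: GCD_set_def)
  then have "degree m = 0" using k(3) by (auto simp: is_unit_poly_iff)
  then have "degree d = 0" by (simp add: m(3) degree_map_poly)
  moreover have "d \<noteq> 0" using d(1) f by auto
  ultimately obtain u where u: "d = [:u:]" "u \<noteq> 0" by (auto elim: degree_eq_zeroE)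
  have "smult (inverse u) a * fract_poly f + smult (inverse u) b * fract_poly g = smult (inverse u) d"
    by (simp add: bezout smult_add_right)
  also have "\<dots> = 1" using u by simp
  finally show ?thesis unfolding comaximal_def by blast
qed

section \<open>Integer-valued polynomials\<close>

lemma mem_Int_poly: "h \<in> Int_poly \<longleftrightarrow> (\<forall>v. \<exists>x. poly h (to_fract v) = to_fract x)"
  by (auto simp: Int_poly_def image_iff)

lemma Int_poly_value:
  assumes "h \<in> Int_poly"
  obtains x where "poly h (to_fract v) = to_fract x"
  using assms by (auto simp: mem_Int_poly)

lemma Int_poly_mult: "r \<in> Int_poly \<Longrightarrow> s \<in> Int_poly \<Longrightarrow> r * s \<in> Int_poly"
  unfolding mem_Int_poly poly_mult by (metis to_fract_mult)

lemma Int_poly_const: "[:to_fract x:] \<in> Int_poly"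
  by (auto simp: mem_Int_poly)

lemma Int_poly_smult: "r \<in> Int_poly \<Longrightarrow> smult (to_fract x) r \<in> Int_poly"
  unfolding mem_Int_poly poly_smult by (metis to_fract_mult)

lemma Int_poly_one: "1 \<in> Int_poly"
  using Int_poly_const[of 1] by (simp add: one_pCons)

lemma Int_poly_power: "r \<in> Int_poly \<Longrightarrow> r ^ n \<in> Int_poly"
  by (induction n) (simp_all add: Int_poly_one Int_poly_mult)

lemma poly_fract_poly: "poly (fract_poly p) (to_fract v) = to_fract (poly p v)"
  by (induction p) (simp_all add: map_poly_pCons)

lemma fract_poly_Int_poly: "fract_poly p \<in> Int_poly"
  by (auto simp: mem_Int_poly poly_fract_poly)

section \<open>Constant divisors of integer-valued polynomials\<close>

definition const_dvd :: "'a::idom \<Rightarrow> 'a fract poly \<Rightarrow> bool" where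
  "const_dvd x h \<longleftrightarrow> (\<exists>h'\<in>Int_poly. h = smult (to_fract x) h')"

lemma const_dvd_trans: "x dvd y \<Longrightarrow> const_dvd y h \<Longrightarrow> const_dvd x h"
proof -
  assume "x dvd y" "const_dvd y h"
  then obtain z where "y = x * z" by (auto elim: dvdE)
  moreover obtain h' where "h' \<in> Int_poly" "h = smult (to_fract y) h'"
    using \<open>const_dvd y h\<close> by (auto simp: const_dvd_def)
  ultimately show ?thesis
    unfolding const_dvd_def by (intro bexI[of _ "smult (to_fract z) h'"] Int_poly_smult) simp_all
qed

text \<open>Over the field \<open>h\<close> can always be divided by \<open>x\<close>, and
  integrality of the quotient is tested value by value. This links divisibility inside
  \<open>Int_poly\<close> to the fixed divisor, which is defined through values.\<close>

lemma const_dvd_iff_values: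
  assumes "x \<noteq> 0" "h \<in> Int_poly"
  shows "const_dvd x h \<longleftrightarrow> (\<forall>v y. poly h (to_fract v) = to_fract y \<longrightarrow> x dvd y)"
proof
  assume "const_dvd x h"
  then obtain h' where h': "h' \<in> Int_poly" "h = smult (to_fract x) h'" by (auto simp: const_dvd_def)
  show "\<forall>v y. poly h (to_fract v) = to_fract y \<longrightarrow> x dvd y"
  proof (intro allI impI)
    fix v y assume y: "poly h (to_fract v) = to_fract y"
    obtain z where "poly h' (to_fract v) = to_fract z" using h'(1) by (rule Int_poly_value)
    then have "to_fract (x * z) = to_fract y" using y by (simp add: h'(2))
    then have "x * z = y" by (simp only: to_fract_eq_iff)
    then show "x dvd y" by auto
  qed
next
  assume *: "\<forall>v y. poly h (to_fract v) = to_fract y \<longrightarrow> x dvd y"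
  define h' where "h' = smult (inverse (to_fract x)) h"
  have "\<exists>z. poly h' (to_fract v) = to_fract z" for v
  proof -
    obtain y where y: "poly h (to_fract v) = to_fract y" using assms(2) by (rule Int_poly_value)
    then obtain z where "y = x * z" using * by (auto elim!: dvdE)
    then have "poly h' (to_fract v) = to_fract z" using y assms(1) by (simp add: h'_def)
    then show ?thesis ..
  qed
  then have "h' \<in> Int_poly" by (simp add: mem_Int_poly)
  moreover have "h = smult (to_fract x) h'" using assms(1) by (simp add: h'_def)
  ultimately show "const_dvd x h" unfolding const_dvd_def by blast
qed

text \<open>At each point the equation makes \<open>p\<close> divide \<open>x\<close> times the
  value of \<open>r\<close>; being prime and not a divisor of \<open>x\<close>, it divides the
  value.\<close>

lemma const_dvd_cancel:
  assumes p: "prime_elem p" and int: "r \<in> Int_poly" "h \<in> Int_poly"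
    and eq: "smult (to_fract (p * y)) h = smult (to_fract x) r" and x: "\<not> p dvd x"
  shows "const_dvd p r"
proof -
  have "p dvd z" if z: "poly r (to_fract v) = to_fract z" for v z
  proof -
    obtain w where "poly h (to_fract v) = to_fract w" using int(2) by (rule Int_poly_value)
    then have "to_fract (p * y * w) = to_fract (x * z)"
      using arg_cong[OF eq, of "\<lambda>q. poly q (to_fract v)"] z by simp
    then have "p * (y * w) = x * z" by (simp only: to_fract_eq_iff mult.assoc)
    then have "p dvd x * z" by (metis dvd_triv_left)
    then show "p dvd z" using x p by (simp add: prime_elem_dvd_mult_iff)
  qed
  moreover have "p \<noteq> 0" using p by auto
  ultimately show ?thesis using const_dvd_iff_values[OF _ int(1)] by blast
qed

section \<open>Prime divisors of the fixed divisor\<close>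

lemma padic_val_ne_0_iff:
  assumes "prime_elem p"
  shows "padic_val p x \<noteq> 0 \<longleftrightarrow> p dvd x"
  using assms multiplicity_eq_zero_iff[of x p]
  by (auto simp: padic_val_def zero_enat_def prime_elem_def)

lemma fixed_exponent_ne_0_iff:
  assumes p: "prime_elem p" and h: "h \<in> Int_poly"
  shows "fixed_exponent p h \<noteq> 0 \<longleftrightarrow> const_dvd p h"
proof -
  \<comment> \<open>Being nonzero means being at least 1, which turns a condition on an infimum into
    one on all members.\<close>
  have "e \<noteq> 0 \<longleftrightarrow> 1 \<le> e" for e :: enat
    by (cases e) (auto simp: one_enat_def zero_enat_def)
  then have "fixed_exponent p h \<noteq> 0 \<longleftrightarrow>
      (\<forall>e\<in>{padic_val p x | x c. to_fract x = poly h (to_fract c)}. e \<noteq> 0)"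
    unfolding fixed_exponent_def by (simp only: le_Inf_iff)
  also have "\<dots> \<longleftrightarrow> (\<forall>y v. to_fract y = poly h (to_fract v) \<longrightarrow> padic_val p y \<noteq> 0)"
    by (simp only: Ball_def mem_Collect_eq) metis
  also have "\<dots> \<longleftrightarrow> (\<forall>v y. poly h (to_fract v) = to_fract y \<longrightarrow> p dvd y)"
    unfolding padic_val_ne_0_iff[OF p] by metis
  also have "\<dots> \<longleftrightarrow> const_dvd p h"
    using const_dvd_iff_values[OF _ h, of p] p by auto
  finally show ?thesis .
qed

lemma nonzero_value:
  fixes h :: "'a::idom fract poly"
  assumes "h \<in> Int_poly" "h \<noteq> 0" "infinite (UNIV :: 'a set)"
  obtains v x where "poly h (to_fract v) = to_fract x" "x \<noteq> 0"
proof -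
  have "inj (to_fract :: 'a \<Rightarrow> _)" by (rule injI) simp
  then have "infinite (range (to_fract :: 'a \<Rightarrow> _))" using assms(3) finite_imageD by blast
  moreover have "finite {x. poly h x = 0}" using assms(2) by (rule poly_roots_finite)
  ultimately have "\<not> range to_fract \<subseteq> {x. poly h x = 0}" using finite_subset by blast
  then obtain v where v: "poly h (to_fract v) \<noteq> 0" by auto
  obtain x where "poly h (to_fract v) = to_fract x" using assms(1) by (rule Int_poly_value)
  then show ?thesis using v that by auto
qed

text \<open>In a finite domain multiplication by a nonzero \<open>p\<close> is injective, hence
  surjective, and \<open>p\<close> would be a unit. So as soon as there is a prime,
  \<open>nonzero_value\<close> is available.\<close>

lemma prime_elem_infinite:
  fixes p :: "'a::idom"
  assumes "prime_elem p"
  shows "infinite (UNIV :: 'a set)"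
proof
  assume fin: "finite (UNIV :: 'a set)"
  have p: "p \<noteq> 0" "\<not> p dvd 1" using assms by (auto simp: prime_elem_def)
  have "inj ((*) p)" using p(1) by (auto intro: injI)
  then have "surj ((*) p)" using fin by (simp add: finite_UNIV_inj_surj)
  then show False using p(2) by (metis dvd_triv_left surjD)
qed

text \<open>A prime that divides another prime is associated to it, and \<open>Q\<close> contains
  one element of each class.\<close>

lemma prime_representatives_dvd_imp_eq:
  fixes Q :: "'a::idom set"
  assumes "prime_representatives Q" "p \<in> Q" "q \<in> Q" "p dvd q"
  shows "p = q"
proof -
  have pq: "prime_elem p" "prime_elem q"
    using assms by (auto simp: prime_representatives_def)
  obtain t where t: "q = p * t" using assms(4) by (rule dvdE)
  have "q dvd p"
  proof -
    have "q dvd p \<or> q dvd t" using pq(2) t by (metis dvd_refl prime_elem_dvd_mult_iff)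
    moreover have "\<not> q dvd t"
    proof
      assume "q dvd t"
      then obtain s where "t = q * s" by (rule dvdE)
      then have "q * (p * s) = q * 1" using t by (simp add: mult_ac)
      then have "p * s = 1" using pq(2) by (simp only: mult_cancel_left) auto
      then have "p dvd 1" by (metis dvd_triv_left)
      then show False using pq(1) by (simp add: prime_elem_def)
    qed
    ultimately show ?thesis by blast
  qed
  moreover have "\<exists>!p. p \<in> Q \<and> p dvd q \<and> q dvd p"
    using assms(1) pq(2) by (simp add: prime_representatives_def)
  ultimately show ?thesis using assms(2-4) dvd_refl[of q] by blast
qed

lemma prime_dvd_fixed_divisor_iff:
  fixes Q :: "'a::{factorial_semiring,idom} set"
  assumes Q: "prime_representatives Q" and p: "p \<in> Q" and h: "h \<in> Int_poly" "h \<noteq> 0"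
  shows "p dvd fixed_divisor Q h \<longleftrightarrow> const_dvd p h"
proof -
  let ?S = "{q. q \<in> Q \<and> fixed_exponent q h \<noteq> 0}"
  have prime: "prime_elem q" if "q \<in> Q" for q
    using Q that by (auto simp: prime_representatives_def)
  \<comment> \<open>The nonzero value \<open>x\<close> controls the whole product: primes with
    nonzero exponent divide it, and each exponent is at most the valuation of
    \<open>x\<close>.\<close>
  obtain v x where x: "poly h (to_fract v) = to_fract x" "x \<noteq> 0"
    using nonzero_value[OF h prime_elem_infinite[OF prime[OF p]]] by blast
  show ?thesis
  proof
    assume "p dvd fixed_divisor Q h"
    then obtain e where "e \<in># image_mset (\<lambda>q. q ^ the_enat (fixed_exponent q h)) (mset_set ?S)" "p dvd e"
      unfolding fixed_divisor_def prod_unfold_prod_mset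
      by (rule prime_elem_dvd_prod_msetE[OF prime[OF p]])
    \<comment> \<open>For an infinite index set the multiset of factors is empty, so that case
      contradicts the choice of \<open>e\<close>.\<close>
    then have "\<exists>q\<in>?S. p dvd q ^ the_enat (fixed_exponent q h)"
      by (cases "finite ?S") auto
    then obtain q where q: "q \<in> ?S" "p dvd q"
      using prime[OF p] prime_elem_dvd_power by blast
    then have "p = q" using prime_representatives_dvd_imp_eq Q p by blast
    then show "const_dvd p h" using q fixed_exponent_ne_0_iff[OF prime[OF p] h(1)] by auto
  next
    assume "const_dvd p h"
    then have ne: "fixed_exponent p h \<noteq> 0" using fixed_exponent_ne_0_iff[OF prime[OF p] h(1)] by auto
    have dvd: "q dvd x" if q: "q \<in> ?S" for q
    proof -
      have "prime_elem q" using prime q by blast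
      then have "const_dvd q h" "q \<noteq> 0"
        using q fixed_exponent_ne_0_iff[of q h] h(1) by auto
      then show ?thesis using const_dvd_iff_values[of q h] h(1) x(1) by blast
    qed
    \<comment> \<open>Distinct representatives are not associated, so normalizing embeds the index
      set into the finite set of prime factors of \<open>x\<close>; this excludes the default value
      1 of an infinite product.\<close>
    have "inj_on normalize ?S"
    proof (rule inj_onI)
      fix q q' assume *: "q \<in> ?S" "q' \<in> ?S" "normalize q = normalize q'"
      then have "q dvd q'" by (intro associatedD1)
      then show "q = q'" using * prime_representatives_dvd_imp_eq[OF Q] by auto
    qed
    moreover have "normalize ` ?S \<subseteq> prime_factors x"
      using dvd x(2) prime by (auto simp: prime_factors_dvd prime_def)
    ultimately have fin: "finite ?S" by (meson finite_imageD finite_set_mset finite_subset)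
    \<comment> \<open>The exponent lies below a finite valuation, so \<open>the_enat\<close> returns
      its actual value.\<close>
    have "fixed_exponent p h \<le> padic_val p x"
      unfolding fixed_exponent_def using x(1) by (intro Inf_lower CollectI exI[of _ x] exI[of _ v]) simp
    then have "fixed_exponent p h \<noteq> \<infinity>" using x(2)
      by (cases "fixed_exponent p h") (auto simp: padic_val_def)
    then have "the_enat (fixed_exponent p h) \<noteq> 0"
      using ne by (cases "fixed_exponent p h") (auto simp: zero_enat_def)
    then have "p dvd p ^ the_enat (fixed_exponent p h)" by simp
    also have "\<dots> dvd fixed_divisor Q h"
      unfolding fixed_divisor_def using fin p ne by (intro dvd_prodI) auto
    finally show "p dvd fixed_divisor Q h" .
  qed
qed

section \<open>Divisor closures\<close>

lemma divisor_closure_Int: "r \<in> divisor_closure f \<Longrightarrow> r \<in> Int_poly"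
  and divisor_closure_nonzero: "r \<in> divisor_closure f \<Longrightarrow> r \<noteq> 0"
  by (auto simp: divisor_closure_def)

lemma divisor_closureI:
  "r \<in> Int_poly \<Longrightarrow> r \<noteq> 0 \<Longrightarrow> u \<in> Int_poly \<Longrightarrow> f ^ k = r * u \<Longrightarrow> r \<in> divisor_closure f"
  unfolding divisor_closure_def by blast

lemma divisor_closureE:
  assumes "r \<in> divisor_closure f"
  obtains k u where "u \<in> Int_poly" "f ^ k = r * u"
  using assms unfolding divisor_closure_def by blast

lemma divisor_closure_one: "1 \<in> divisor_closure f"
  by (rule divisor_closureI[of _ 1 _ 0]) (simp_all add: Int_poly_one)

lemma divisor_closure_mult:
  assumes r: "r \<in> divisor_closure f" and s: "s \<in> divisor_closure f"
  shows "r * s \<in> divisor_closure f"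
proof -
  obtain k u where u: "u \<in> Int_poly" "f ^ k = r * u" using r by (rule divisor_closureE)
  obtain l w where w: "w \<in> Int_poly" "f ^ l = s * w" using s by (rule divisor_closureE)
  have "f ^ (k + l) = (r * s) * (u * w)" by (simp add: power_add u w mult_ac)
  then show ?thesis
    using r s u w by (intro divisor_closureI[of _ "u * w"])
      (auto simp: Int_poly_mult divisor_closure_Int divisor_closure_nonzero)
qed

lemma divisor_closure_factor:
  assumes "r * s \<in> divisor_closure f" "r \<in> Int_poly" "s \<in> Int_poly"
  shows "r \<in> divisor_closure f"
proof -
  obtain k u where u: "u \<in> Int_poly" "f ^ k = r * s * u" using assms(1) by (rule divisor_closureE)
  have "f ^ k = r * (s * u)" by (simp add: u mult.assoc)
  moreover have "r \<noteq> 0" using divisor_closure_nonzero[OF assms(1)] by auto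
  ultimately show ?thesis using assms u by (intro divisor_closureI[of _ "s * u" _ k])
      (simp_all add: Int_poly_mult)
qed

lemma divisor_closure_unit:
  assumes "x dvd 1"
  shows "[:to_fract x:] \<in> divisor_closure f"
proof -
  obtain y where "1 = x * y" using assms by (rule dvdE)
  then have "to_fract x * to_fract y = 1" by (metis to_fract_1 to_fract_mult)
  then have "[:to_fract x:] * [:to_fract y:] = 1" by (simp add: one_pCons mult.commute)
  then show ?thesis
    by (metis Int_poly_const divisor_closure_factor divisor_closure_one)
qed

lemma divisor_closure_power:
  assumes "f \<in> Int_poly" "f \<noteq> 0"
  shows "f ^ k \<in> divisor_closure f"
  using assms by (intro divisor_closureI[of _ 1 _ k]) (simp_all add: Int_poly_power Int_poly_one)

lemma divisor_closure_times:
  assumes r: "r \<in> divisor_closure f" and s: "s \<in> divisor_closure g"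
    and "f \<in> Int_poly" "g \<in> Int_poly"
  shows "r * s \<in> divisor_closure (f * g)"
proof -
  obtain k u where u: "u \<in> Int_poly" "f ^ k = r * u" using r by (rule divisor_closureE)
  obtain l w where w: "w \<in> Int_poly" "g ^ l = s * w" using s by (rule divisor_closureE)
  \<comment> \<open>The factor \<open>f ^ l * g ^ k\<close> makes up for the different exponents
    \<open>k\<close> and \<open>l\<close>.\<close>
  have "(f * g) ^ (k + l) = (r * s) * (u * w * (f ^ l * g ^ k))"
    by (simp add: power_mult_distrib power_add u w mult_ac)
  then show ?thesis
    using assms u w by (intro divisor_closureI[of _ "u * w * (f ^ l * g ^ k)"])
      (auto simp: Int_poly_mult Int_poly_power divisor_closure_Int divisor_closure_nonzero)
qed

lemma divisor_closure_const_mult: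
  "[:c:] \<in> divisor_closure f \<Longrightarrow> r \<in> divisor_closure f \<Longrightarrow> smult c r \<in> divisor_closure f"
  using divisor_closure_mult[of "[:c:]" f r] by simp

lemma fract_poly_in_divisor_closure:
  assumes "r dvd f ^ k" "f \<noteq> 0"
  shows "fract_poly r \<in> divisor_closure (fract_poly f)"
proof -
  obtain t where t: "f ^ k = r * t" using assms(1) by (rule dvdE)
  have "fract_poly (f ^ k) = fract_poly f ^ k" by (induction k) simp_all
  then have "fract_poly f ^ k = fract_poly r * fract_poly t" by (simp add: t)
  moreover have "r \<noteq> 0" using assms t by auto
  ultimately show ?thesis
    by (intro divisor_closureI[of _ "fract_poly t"]) (simp_all add: fract_poly_Int_poly)
qed

section \<open>Factorisation of the divisor closure of a product\<close>

text \<open>This isolates what multiplicativity of the fixed divisor yields for single primes, free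
  of the chosen representatives.\<close>

locale multiplicative_primes =
  fixes F G :: "'a::{factorial_semiring,idom} fract poly"
  assumes Int: "F \<in> Int_poly" "G \<in> Int_poly"
    and nonzero: "F \<noteq> 0" "G \<noteq> 0"
    and const_dvd_times: "prime_elem p \<Longrightarrow> r \<in> divisor_closure F \<Longrightarrow> s \<in> divisor_closure G \<Longrightarrow>
      const_dvd p (r * s) \<Longrightarrow> const_dvd p r \<or> const_dvd p s"
begin

text \<open>The prime divides \<open>F ^ k * G ^ k\<close> in \<open>Int_poly\<close>, and
  \<open>const_dvd_times\<close> applies to these two powers.\<close>

lemma prime_in_divisor_closure:
  assumes p: "prime_elem p" and "[:to_fract p:] \<in> divisor_closure (F * G)"
  shows "[:to_fract p:] \<in> divisor_closure F \<or> [:to_fract p:] \<in> divisor_closure G"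
proof -
  have mem: "[:to_fract p:] \<in> divisor_closure f"
    if dvd: "const_dvd p (f ^ k)" and "f \<in> Int_poly" "f \<noteq> 0" for f :: "'a fract poly" and k
  proof -
    obtain u where "u \<in> Int_poly" "f ^ k = smult (to_fract p) u"
      using dvd by (auto simp: const_dvd_def)
    then show ?thesis
      using p that(2,3) by (intro divisor_closureI[of _ u _ k]) (auto simp: Int_poly_const)
  qed
  obtain k u where u: "u \<in> Int_poly" "(F * G) ^ k = [:to_fract p:] * u"
    using assms(2) by (rule divisor_closureE)
  then have "const_dvd p (F ^ k * G ^ k)"
    by (auto simp: const_dvd_def power_mult_distrib)
  then have "const_dvd p (F ^ k) \<or> const_dvd p (G ^ k)"
    using p Int nonzero by (intro const_dvd_times divisor_closure_power)
  then show ?thesis using mem Int nonzero by blast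
qed

text \<open>Each prime of the numerator \<open>x\<close> divides an element of the closure of
  \<open>F * G\<close>, hence lies in the closure of \<open>F\<close> or of \<open>G\<close> and can
  be moved into \<open>r\<close> or \<open>s\<close>.\<close>

lemma const_multiple_splits:
  assumes "x \<noteq> 0" "smult (to_fract x) (r * s) \<in> divisor_closure (F * G)"
    and "r \<in> divisor_closure F" "s \<in> divisor_closure G"
  shows "\<exists>r'\<in>divisor_closure F. \<exists>s'\<in>divisor_closure G. smult (to_fract x) (r * s) = r' * s'"
  using assms
proof (induction x arbitrary: r s rule: prime_divisors_induct)
  case (unit x)
  then have "smult (to_fract x) r \<in> divisor_closure F"
    by (intro divisor_closure_const_mult divisor_closure_unit)
  then show ?case using unit.prems(4) by (intro bexI) auto
next
  case (factor p x)
  have p: "prime_elem p" "x \<noteq> 0" using factor by auto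
  have int: "r * s \<in> Int_poly"
    using factor.prems by (intro Int_poly_mult divisor_closure_Int)
  have eq: "smult (to_fract (p * x)) (r * s) = [:to_fract p:] * smult (to_fract x) (r * s)"
    by (simp add: mult.commute[of "to_fract p"])
  have "[:to_fract p:] \<in> divisor_closure (F * G)"
    using factor.prems(2) unfolding eq
    by (rule divisor_closure_factor) (intro Int_poly_const Int_poly_smult int)+
  then consider "[:to_fract p:] \<in> divisor_closure F" | "[:to_fract p:] \<in> divisor_closure G"
    using prime_in_divisor_closure[OF p(1)] by blast
  then show ?case
  proof cases
    case 1
    have eq: "smult (to_fract (p * x)) (r * s) = smult (to_fract x) (smult (to_fract p) r * s)"
      by (simp only: mult_smult_left smult_smult to_fract_mult mult.commute[of "to_fract p"])
    show ?thesis
      unfolding eq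
      by (rule factor.IH[OF p(2) factor.prems(2)[unfolded eq]
            divisor_closure_const_mult[OF 1 factor.prems(3)] factor.prems(4)])
  next
    case 2
    have eq: "smult (to_fract (p * x)) (r * s) = smult (to_fract x) (r * smult (to_fract p) s)"
      by (simp only: mult_smult_right smult_smult to_fract_mult mult.commute[of "to_fract p"])
    show ?thesis
      unfolding eq
      by (rule factor.IH[OF p(2) factor.prems(2)[unfolded eq] factor.prems(3)
            divisor_closure_const_mult[OF 2 factor.prems(4)]])
  qed
qed simp

text \<open>A prime of the denominator \<open>y\<close> is cancelled from \<open>x\<close> if it
  divides \<open>x\<close>; otherwise it divides all values of \<open>r * s\<close>, hence of
  \<open>r\<close> or of \<open>s\<close>, and is divided out there. Once \<open>y\<close> is a
  unit, \<open>const_multiple_splits\<close> absorbs the numerator.\<close>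

lemma proportional_splits:
  assumes "y \<noteq> 0" "smult (to_fract y) h = smult (to_fract x) (r * s)"
    and "h \<in> divisor_closure (F * G)" "r \<in> divisor_closure F" "s \<in> divisor_closure G"
  shows "\<exists>r'\<in>divisor_closure F. \<exists>s'\<in>divisor_closure G. h = r' * s'"
  using assms
proof (induction y arbitrary: x r s rule: prime_divisors_induct)
  case (unit y)
  obtain y' where "1 = y * y'" using unit.hyps by (rule dvdE)
  then have "to_fract y' * to_fract y = 1" by (metis mult.commute to_fract_1 to_fract_mult)
  then have "h = smult (to_fract y') (smult (to_fract y) h)" by simp
  also have "\<dots> = smult (to_fract (y' * x)) (r * s)" by (simp add: unit.prems(2))
  finally have h: "h = smult (to_fract (y' * x)) (r * s)" .
  have "y' * x \<noteq> 0" using h divisor_closure_nonzero[OF unit.prems(3)] by auto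
  then show ?case
    using const_multiple_splits[of "y' * x" r s] unit.prems(3-5) unfolding h by blast
next
  case (factor p y)
  have p: "prime_elem p" "p \<noteq> 0" "y \<noteq> 0" using factor by auto
  have int: "r \<in> Int_poly" "s \<in> Int_poly" "h \<in> Int_poly"
    using factor.prems divisor_closure_Int by blast+
  \<comment> \<open>Dividing out \<open>p\<close> stays in the closure, since the quotient is
    integer valued and a factor of \<open>t\<close>.\<close>
  have pfactor: "\<exists>t'. t = smult (to_fract p) t' \<and> t' \<in> divisor_closure f"
    if dvd: "const_dvd p t" and t: "t \<in> divisor_closure f" for t f
  proof -
    obtain t' where t': "t' \<in> Int_poly" "t = t' * [:to_fract p:]"
      using dvd by (auto simp: const_dvd_def)
    then show ?thesis using divisor_closure_factor[of t' "[:to_fract p:]" f] t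
      by (auto simp: Int_poly_const)
  qed
  have cancel: "smult (to_fract y) h = q" if "smult (to_fract (p * y)) h = smult (to_fract p) q" for q
    by (rule smult_cancel[of "to_fract p"]) (use that p in simp_all)
  show ?case
  proof (cases "p dvd x")
    case True
    then obtain x' where "x = p * x'" by (rule dvdE)
    then have "smult (to_fract y) h = smult (to_fract x') (r * s)"
      using factor.prems(2) by (intro cancel) simp
    then show ?thesis using factor.IH[OF p(3)] factor.prems(3-5) by blast
  next
    case False
    have "const_dvd p (r * s)"
      by (rule const_dvd_cancel[OF p(1) Int_poly_mult[OF int(1,2)] int(3) factor.prems(2) False])
    then consider "const_dvd p r" | "const_dvd p s"
      using const_dvd_times p(1) factor.prems by blast
    then show ?thesis
    proof cases
      case 1
      then obtain r' where r': "r = smult (to_fract p) r'" "r' \<in> divisor_closure F"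
        using pfactor factor.prems by blast
      then have "smult (to_fract y) h = smult (to_fract x) (r' * s)"
        using factor.prems(2) by (intro cancel) (simp add: mult.commute)
      then show ?thesis using factor.IH[OF p(3)] factor.prems(3-5) r'(2) by blast
    next
      case 2
      then obtain s' where s': "s = smult (to_fract p) s'" "s' \<in> divisor_closure G"
        using pfactor factor.prems by blast
      then have "smult (to_fract y) h = smult (to_fract x) (r * s')"
        using factor.prems(2) by (intro cancel) (simp add: mult.commute)
      then show ?thesis using factor.IH[OF p(3)] factor.prems(3-5) s'(2) by blast
    qed
  qed
qed simp

end

text \<open>With \<open>d\<close> the greatest common divisor of \<open>h\<close> and
  \<open>p\<close>, the cofactor of \<open>d\<close> in \<open>h\<close> is comaximal to that in
  \<open>p\<close>, so it divides \<open>q\<close>.\<close>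

lemma dvd_mult_split_field_poly:
  fixes h p q :: "'k::field poly"
  assumes "h dvd p * q" "h \<noteq> 0"
  obtains r s where "r dvd p" "s dvd q" "h = r * s"
proof -
  obtain d a b where d: "d dvd h" "d dvd p" "d = a * h + b * p"
    by (rule field_poly_bezout)
  obtain s where s: "h = d * s" using d(1) by (rule dvdE)
  obtain p' where p': "p = d * p'" using d(2) by (rule dvdE)
  have d0: "d \<noteq> 0" using s assms(2) by auto
  have "d * (a * s + b * p') = a * (d * s) + b * (d * p')" by (simp add: algebra_simps)
  also have "\<dots> = d * 1" unfolding s[symmetric] p'[symmetric] by (simp add: d(3))
  finally have "d * (a * s + b * p') = d * 1" .
  then have "a * s + b * p' = 1" using d0 by (simp only: mult_cancel_left) simp
  then have "comaximal s p'" unfolding comaximal_def by blast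
  moreover have "s dvd p' * q"
    using assms(1) d0 by (simp add: s p' mult.assoc)
  ultimately have "s dvd q" by (rule comaximal_dvd_mult)
  then show ?thesis using that d(2) s by blast
qed

lemma divisor_closure_fract_mult:
  fixes f g :: "'a::{factorial_semiring,idom} poly"
  assumes "f \<noteq> 0" "g \<noteq> 0" and "multiplicative_primes (fract_poly f) (fract_poly g)"
  shows "divisor_closure (fract_poly (f * g)) =
    divisor_closure (fract_poly f) * divisor_closure (fract_poly g)"
proof
  interpret multiplicative_primes "fract_poly f" "fract_poly g" by fact
  show "divisor_closure (fract_poly f) * divisor_closure (fract_poly g) \<subseteq>
      divisor_closure (fract_poly (f * g))"
    by (auto simp: divisor_closure_times Int elim!: set_times_elim)
  show "divisor_closure (fract_poly (f * g)) \<subseteq>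
      divisor_closure (fract_poly f) * divisor_closure (fract_poly g)"
  proof
    fix h assume h: "h \<in> divisor_closure (fract_poly (f * g))"
    have pow: "fract_poly p ^ k = fract_poly (p ^ k)" for p :: "'a poly" and k
      by (induction k) simp_all
    obtain k u where u: "u \<in> Int_poly" "fract_poly (f * g) ^ k = h * u"
      using h by (rule divisor_closureE)
    then have "fract_poly (f ^ k) * fract_poly (g ^ k) = h * u"
      by (simp add: power_mult_distrib flip: pow)
    then have "h dvd fract_poly (f ^ k) * fract_poly (g ^ k)" by simp
    then obtain r s where rs: "r dvd fract_poly (f ^ k)" "s dvd fract_poly (g ^ k)" "h = r * s"
      using divisor_closure_nonzero[OF h] by (rule dvd_mult_split_field_poly)
    obtain r0 c where r0: "r0 dvd f ^ k" "c \<noteq> 0" "r = smult c (fract_poly r0)"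
      using rs(1) by (rule fract_poly_factor_lift)
    obtain s0 e where s0: "s0 dvd g ^ k" "e \<noteq> 0" "s = smult e (fract_poly s0)"
      using rs(2) by (rule fract_poly_factor_lift)
    \<comment> \<open>The lifts to the base ring leave one constant \<open>c * e\<close>; its
      numerator and denominator are the input of \<open>proportional_splits\<close>.\<close>
    obtain x y where x: "c * e = to_fract x / to_fract y" "y \<noteq> 0" by (rule fract_cases)
    have "h = smult (c * e) (fract_poly r0 * fract_poly s0)"
      by (simp add: rs(3) r0(3) s0(3) mult.commute)
    then have "smult (to_fract y) h = smult (to_fract x) (fract_poly r0 * fract_poly s0)"
      using x by simp
    from proportional_splits[OF x(2) this h[unfolded fract_poly_mult] fract_poly_in_divisor_closure[OF r0(1) assms(1)]
        fract_poly_in_divisor_closure[OF s0(1) assms(2)]]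
    obtain r' s' where "r' \<in> divisor_closure (fract_poly f)"
      "s' \<in> divisor_closure (fract_poly g)" "h = r' * s'"
      by blast
    then show "h \<in> divisor_closure (fract_poly f) * divisor_closure (fract_poly g)"
      by auto
  qed
qed

section \<open>Common fractions of the two divisor closures\<close>

lemma divisor_closure_prime_value:
  assumes p: "prime_elem p" and r: "r \<in> divisor_closure (fract_poly f)"
    and v: "poly r (to_fract a) = to_fract v" "p dvd v"
  shows "p dvd poly f a"
proof -
  obtain k u where u: "u \<in> Int_poly" "fract_poly f ^ k = r * u"
    using r by (rule divisor_closureE)
  obtain w where w: "poly u (to_fract a) = to_fract w" using u(1) by (rule Int_poly_value)
  have pow: "to_fract x ^ k = to_fract (x ^ k)" for x :: 'a
    by (induction k) simp_all
  \<comment> \<open>Evaluating at \<open>a\<close> shows that the value of \<open>r\<close> divides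
    a power of \<open>poly f a\<close>.\<close>
  have "poly (fract_poly f ^ k) (to_fract a) = to_fract (v * w)" by (simp add: u(2) v w)
  then have "to_fract (poly f a ^ k) = to_fract (v * w)"
    by (simp add: poly_fract_poly poly_power pow)
  then have "poly f a ^ k = v * w" by (simp only: to_fract_eq_iff)
  then have "p dvd poly f a ^ k" using v(2) by simp
  then show ?thesis using p prime_elem_dvd_power by blast
qed

text \<open>Evaluate both equations at \<open>a\<close> and write \<open>c\<close> as
  \<open>x / y\<close>. A prime of \<open>y\<close> not dividing \<open>x\<close> would divide the
  values of both \<open>r'\<close> and \<open>s'\<close>, hence \<open>poly f a\<close> and
  \<open>poly g a\<close>.\<close>

lemma common_ratio_integral:
  fixes f g :: "'a::{factorial_semiring,idom} poly"
  assumes coprime: "\<And>p. prime_elem p \<Longrightarrow> \<not> (p dvd poly f a \<and> p dvd poly g a)"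
    and r: "r \<in> divisor_closure (fract_poly f)" "r' \<in> divisor_closure (fract_poly f)"
    and s: "s \<in> divisor_closure (fract_poly g)" "s' \<in> divisor_closure (fract_poly g)"
    and eq: "r = smult c r'" "s = smult c s'"
  obtains z where "c = to_fract z"
proof -
  obtain x y where c: "c = to_fract x / to_fract y" "y \<noteq> 0" by (rule fract_cases)
  have integral_values: "\<exists>v w. poly t (to_fract a) = to_fract v \<and> poly t' (to_fract a) = to_fract w \<and> y * v = x * w"
    if t: "t \<in> Int_poly" "t' \<in> Int_poly" "t = smult c t'" for t t'
  proof -
    obtain v where v: "poly t (to_fract a) = to_fract v" using t(1) by (rule Int_poly_value)
    obtain w where w: "poly t' (to_fract a) = to_fract w" using t(2) by (rule Int_poly_value)
    have "to_fract (y * v) = to_fract (x * w)"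
      using v w c by (simp add: t(3) field_simps)
    then show ?thesis using v w by (auto simp only: to_fract_eq_iff)
  qed
  obtain v1 w1 where 1: "poly r' (to_fract a) = to_fract w1" "y * v1 = x * w1"
    using integral_values[OF r[THEN divisor_closure_Int] eq(1)] by blast
  obtain v2 w2 where 2: "poly s' (to_fract a) = to_fract w2" "y * v2 = x * w2"
    using integral_values[OF s[THEN divisor_closure_Int] eq(2)] by blast
  have no_prime: "\<not> (p dvd w1 \<and> p dvd w2)" if "prime_elem p" for p
    using coprime that divisor_closure_prime_value[OF that r(2) 1(1)]
      divisor_closure_prime_value[OF that s(2) 2(1)] by blast
  \<comment> \<open>The four values stay fixed throughout the induction; each common prime is
    removed from \<open>y\<close> and \<open>x\<close> only.\<close>
  have "y dvd x"
    using \<open>y \<noteq> 0\<close> 1(2) 2(2)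
  proof (induction y arbitrary: x rule: prime_divisors_induct)
    case (unit y)
    then show ?case by (meson dvd_trans one_dvd)
  next
    case (factor p y)
    have p: "prime_elem p" "p \<noteq> 0" "y \<noteq> 0" using factor by auto
    have "p dvd x * w1" "p dvd x * w2"
      unfolding factor.prems(2,3)[symmetric] by (simp_all add: mult.assoc)
    then have "p dvd x" using p(1) no_prime by (auto simp: prime_elem_dvd_mult_iff)
    then obtain x' where x': "x = p * x'" by (rule dvdE)
    then have "y * v1 = x' * w1" "y * v2 = x' * w2"
      using factor.prems(2,3) p(2) by (auto simp: mult.assoc)
    then have "y dvd x'" using factor.IH p(3) by blast
    then show ?case by (simp add: x')
  qed simp
  then obtain z where "x = y * z" by (rule dvdE)
  then have "c = to_fract z" using c by simp
  then show ?thesis by (rule that)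
qed

text \<open>Elements of the two closures divide powers of comaximal polynomials, so \<open>r\<close>
  and \<open>r'\<close> divide each other and differ by a constant of the field. Integrality of this
  constant and of its inverse makes it a unit.\<close>

lemma divisor_closures_common_fraction:
  fixes f g :: "'a::{factorial_semiring,idom} poly"
  assumes coprime: "\<And>p. prime_elem p \<Longrightarrow> \<not> (p dvd poly f a \<and> p dvd poly g a)"
    and comax: "comaximal (fract_poly f) (fract_poly g)"
    and r: "r \<in> divisor_closure (fract_poly f)" "r' \<in> divisor_closure (fract_poly f)"
    and s: "s \<in> divisor_closure (fract_poly g)" "s' \<in> divisor_closure (fract_poly g)"
    and eq: "r * s' = r' * s"
  obtains z where "z dvd 1" "r = smult (to_fract z) r'" "s = smult (to_fract z) s'"
proof -
  have dvd_pow: "\<exists>k. t dvd F ^ k" if t: "t \<in> divisor_closure F" for t F :: "'a fract poly"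
  proof -
    obtain k u where "F ^ k = t * u" using t by (rule divisor_closureE)
    then have "t dvd F ^ k" by simp
    then show ?thesis ..
  qed
  have comax': "comaximal t u"
    if t: "t \<in> divisor_closure (fract_poly f)" and u: "u \<in> divisor_closure (fract_poly g)" for t u
  proof -
    obtain k l where "t dvd fract_poly f ^ k" "u dvd fract_poly g ^ l"
      using dvd_pow[OF t] dvd_pow[OF u] by blast
    then show ?thesis by (rule comaximal_dvd_powers[OF comax])
  qed
  have nz: "r \<noteq> 0" "r' \<noteq> 0" "s \<noteq> 0" "s' \<noteq> 0" using r s divisor_closure_nonzero by blast+
  have "r dvd s * r'" unfolding mult.commute[of s] eq[symmetric] by simp
  then have "r dvd r'" by (rule comaximal_dvd_mult[OF comax'[OF r(1) s(1)]])
  have "r' dvd s' * r" unfolding mult.commute[of s'] eq by simp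
  then have "r' dvd r" by (rule comaximal_dvd_mult[OF comax'[OF r(2) s(2)]])
  then obtain t where t: "r = r' * t" by (rule dvdE)
  have "degree r \<le> degree r'" using \<open>r dvd r'\<close> nz by (simp add: dvd_imp_degree_le)
  then have "degree t = 0" using t nz by (simp add: degree_mult_eq)
  then obtain c where "t = [:c:]" by (rule degree_eq_zeroE)
  then have rc: "r = smult c r'" using t by simp
  then have c0: "c \<noteq> 0" using nz by auto
  have "r' * s = r' * smult c s'" using eq by (simp add: rc)
  then have sc: "s = smult c s'" by (rule mult_left_cancel[OF nz(2), THEN iffD1])
  have rc': "r' = smult (inverse c) r" and sc': "s' = smult (inverse c) s"
    unfolding rc sc using c0 by simp_all
  obtain z where z: "c = to_fract z"
    by (rule common_ratio_integral[OF coprime r s rc sc])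
  \<comment> \<open>The situation is symmetric under exchanging \<open>r\<close> with
    \<open>r'\<close> and \<open>s\<close> with \<open>s'\<close>, which inverts
    \<open>c\<close>.\<close>
  obtain z' where z': "inverse c = to_fract z'"
    by (rule common_ratio_integral[OF coprime r(2,1) s(2,1) rc' sc'])
  have "to_fract (z * z') = to_fract 1" by (simp only: to_fract_mult z[symmetric] z'[symmetric]) (simp add: c0)
  then have "z * z' = 1" by (simp only: to_fract_eq_iff)
  then have "z dvd 1" by (metis dvd_triv_left)
  moreover have "r = smult (to_fract z) r'" "s = smult (to_fract z) s'"
    by (simp_all only: z[symmetric] rc[symmetric] sc[symmetric])
  ultimately show ?thesis by (rule that)
qed

section \<open>Quotient groups\<close>

abbreviation fractions :: "'b::idom set \<Rightarrow> 'b fract set" where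
  "fractions M \<equiv> {Fract x y | x y. x \<in> M \<and> y \<in> M}"

lemma class_group_v_eq: "class_group_v M = v_class_group (field_group (fractions M)) (to_fract ` M)"
  by (simp add: class_group_v_def quotient_group_def field_group_def)

lemma to_fract_image_times: "to_fract ` (M * N) = (to_fract ` M) * (to_fract ` N)"
proof (intro equalityI subsetI)
  show "z \<in> to_fract ` M * to_fract ` N" if "z \<in> to_fract ` (M * N)" for z
    using that by (auto elim!: set_times_elim intro!: set_times_intro)
  show "z \<in> to_fract ` (M * N)" if "z \<in> to_fract ` M * to_fract ` N" for z
    using that by (auto elim!: set_times_elim simp flip: to_fract_mult)
qed

lemma fractions_times:
  fixes M N :: "'b::idom set"
  shows "fractions (M * N) = fractions M * fractions N"
proof (intro equalityI subsetI)
  fix z assume "z \<in> fractions (M * N)"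
  then obtain a b c d where "a \<in> M" "b \<in> N" "c \<in> M" "d \<in> N" "z = Fract (a * b) (c * d)"
    by (auto elim!: set_times_elim)
  moreover from this have "Fract a c \<in> fractions M" "Fract b d \<in> fractions N" by blast+
  ultimately show "z \<in> fractions M * fractions N"
    by (simp flip: mult_fract add: set_times_intro)
next
  fix z assume "z \<in> fractions M * fractions N"
  then obtain a b c d where "a \<in> M" "b \<in> N" "c \<in> M" "d \<in> N" "z = Fract a c * Fract b d"
    by (auto elim!: set_times_elim)
  then have "a * b \<in> M * N" "c * d \<in> M * N" "z = Fract (a * b) (c * d)" by auto
  then show "z \<in> fractions (M * N)" by blast
qed

lemma fraction_monoid_fractions:
  fixes M :: "'b::idom set"
  assumes "0 \<notin> M" "1 \<in> M" and mult: "\<And>x y. x \<in> M \<Longrightarrow> y \<in> M \<Longrightarrow> x * y \<in> M"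
  shows "fraction_monoid (fractions M) (to_fract ` M)"
proof
  show "0 \<notin> fractions M"
  proof
    assume "0 \<in> fractions M"
    then obtain x y where "x \<in> M" "y \<in> M" "0 = Fract x y" by blast
    \<comment> \<open>\<open>Fract x 0\<close> is 0, so \<open>0 \<notin> M\<close> is applied to
      the denominator as well as to the numerator.\<close>
    then show False using assms(1) by (auto simp: Fract_conv_to_fract)
  qed
  show "x * y \<in> fractions M" if xy: "x \<in> fractions M" "y \<in> fractions M" for x y
  proof -
    obtain a b c d where *: "a \<in> M" "b \<in> M" "c \<in> M" "d \<in> M" "x = Fract a b" "y = Fract c d"
      using xy by auto
    then have "x * y = Fract (a * c) (b * d)" by simp
    then show ?thesis using * mult by blast
  qed
  show "inverse x \<in> fractions M" if x: "x \<in> fractions M" for x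
  proof -
    obtain a b where "a \<in> M" "b \<in> M" "inverse x = Fract b a" using x by auto
    then show ?thesis by blast
  qed
  show "to_fract ` M \<subseteq> fractions M"
    using assms(2) by (auto simp: to_fract_def)
  show "1 \<in> to_fract ` M" using assms(2) by (metis image_eqI to_fract_1)
  show "x * y \<in> to_fract ` M" if "x \<in> to_fract ` M" "y \<in> to_fract ` M" for x y
    using that mult by (auto simp flip: to_fract_mult)
  show "\<exists>c\<in>to_fract ` M. c * x \<in> to_fract ` M" if x: "x \<in> fractions M" for x
  proof -
    obtain a b where *: "a \<in> M" "b \<in> M" "x = Fract a b" using x by auto
    then have "to_fract b * x = to_fract a" using assms(1) by (auto simp: Fract_conv_to_fract)
    then show ?thesis using * by (metis image_eqI)
  qed
qed

theorem proposition5p6: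
  fixes Q :: "'a::{factorial_semiring, idom} set"
    and a :: 'a
    and f g :: "'a poly"
  assumes "prime_representatives Q"
    and "f \<noteq> 0" and "g \<noteq> 0"
    and "GCD_set f g = {u. u dvd 1}"
    and "GCD_set (poly f a) (poly g a) = {u. u dvd 1}"
    and "\<And>r s. r \<in> divisor_closure (map_poly to_fract f) \<Longrightarrow>
               s \<in> divisor_closure (map_poly to_fract g) \<Longrightarrow>
               fixed_divisor Q (r * s) = fixed_divisor Q r * fixed_divisor Q s"
  shows "class_group_v (divisor_closure (map_poly to_fract (f * g))) \<cong>
         class_group_v (divisor_closure (map_poly to_fract f)) \<times>\<times>
         class_group_v (divisor_closure (map_poly to_fract g))"
proof -
  let ?M = "divisor_closure (fract_poly f)" and ?N = "divisor_closure (fract_poly g)"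
  have mult: "multiplicative_primes (fract_poly f) (fract_poly g)"
  proof
    fix p :: 'a and r s
    assume p: "prime_elem p" and r: "r \<in> ?M" and s: "s \<in> ?N" and dvd: "const_dvd p (r * s)"
    note int = divisor_closure_Int[OF r] divisor_closure_Int[OF s]
    note nz = divisor_closure_nonzero[OF r] divisor_closure_nonzero[OF s]
    \<comment> \<open>The fixed divisor only sees representatives, so \<open>p\<close> is replaced
      by its associate \<open>q\<close> in \<open>Q\<close> and restored at the end.\<close>
    have "\<exists>!q. q \<in> Q \<and> q dvd p \<and> p dvd q"
      using assms(1) p by (simp add: prime_representatives_def)
    then obtain q where q: "q \<in> Q" "q dvd p" "p dvd q" by blast
    have "prime_elem q" using assms(1) q(1) by (simp add: prime_representatives_def)
    moreover have "q dvd fixed_divisor Q (r * s)"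
      using prime_dvd_fixed_divisor_iff[OF assms(1) q(1) Int_poly_mult[OF int]] nz
        const_dvd_trans[OF q(2) dvd] by simp
    ultimately have "q dvd fixed_divisor Q r \<or> q dvd fixed_divisor Q s"
      unfolding assms(6)[OF r s] by (simp add: prime_elem_dvd_mult_iff)
    then have "const_dvd q r \<or> const_dvd q s"
      using prime_dvd_fixed_divisor_iff[OF assms(1) q(1)] int nz by blast
    then show "const_dvd p r \<or> const_dvd p s" using const_dvd_trans[OF q(3)] by blast
  qed (use assms in \<open>simp_all add: fract_poly_Int_poly\<close>)
  have coprime: "\<not> (p dvd poly f a \<and> p dvd poly g a)" if "prime_elem p" for p
  proof -
    have "1 \<in> GCD_set (poly f a) (poly g a)" by (simp add: assms(5))
    then show ?thesis using that unfolding GCD_set_def prime_elem_def by blast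
  qed
  have comax: "comaximal (fract_poly f) (fract_poly g)"
    using assms by (intro comaximal_fract_poly)
  interpret one: fraction_monoid "fractions ?M" "to_fract ` ?M"
    by (rule fraction_monoid_fractions)
      (auto simp: divisor_closure_one divisor_closure_mult dest: divisor_closure_nonzero)
  interpret two: fraction_monoid "fractions ?N" "to_fract ` ?N"
    by (rule fraction_monoid_fractions)
      (auto simp: divisor_closure_one divisor_closure_mult dest: divisor_closure_nonzero)
  interpret monoid_splitting "fractions ?M" "to_fract ` ?M" "fractions ?N" "to_fract ` ?N"
  proof
    show "fractions ?M \<inter> fractions ?N \<subseteq> to_fract ` ?M \<inter> to_fract ` ?N"
    proof
      fix x assume "x \<in> fractions ?M \<inter> fractions ?N"
      then obtain r r' s s' where r: "r \<in> ?M" "r' \<in> ?M" "x = Fract r r'"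
        and s: "s \<in> ?N" "s' \<in> ?N" "x = Fract s s'" by blast
      have nz: "r' \<noteq> 0" "s' \<noteq> 0" using r s divisor_closure_nonzero by blast+
      have "r * s' = r' * s"
        using r(3) s(3) nz by (simp add: eq_fract mult.commute)
      then obtain z where z: "z dvd 1" "r = smult (to_fract z) r'"
        using divisor_closures_common_fraction[OF coprime comax r(1,2) s(1,2)] by blast
      \<comment> \<open>The common fraction is a unit constant, and unit constants belong to every
        divisor closure.\<close>
      have "x = to_fract [:to_fract z:]"
        using r(3) nz(1) by (simp add: z(2) to_fract_def eq_fract)
      then show "x \<in> to_fract ` ?M \<inter> to_fract ` ?N"
        using divisor_closure_unit[OF z(1)] by blast
    qed
  qed
  show ?thesis
    using v_class_group_iso
    unfolding class_group_v_eq divisor_closure_fract_mult[OF assms(2,3) mult]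
      fractions_times to_fract_image_times .
qed

end
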